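(* Let $X$ be a metric space with integer valued metric. Suppose that for every $f\in\mathrm{E}(X)$ there exist $\varepsilon,N>0$ such that $\mathrm{rk}(A(g))\le N$ for all $g\in\mathrm{E}'(X)$ with $\|f-g\|_\infty<\varepsilon$. Then: (1) $\mathrm{E}'(X)=\mathrm{E}(X)$; (2) $\mathscr P=\{P(A)\}_{A\in\mathscr A(X)}$ is a polyhedral structure on $\mathrm{E}(X)$ with locally finite dimension, in which $P(A')$ is a face of $P(A)$ if and only if $A\subset A'$; (3) for every $n\ge1$ and $D>0$, $\mathscr P$ has only finitely many isometry types of $n$-cells with diameter at most $D$; if in addition $X$ is discretely path-connected, then for every $n$ there are only finitely many isometry types of $n$-cells.
   Context: $\Delta(X)=\{f\in\mathbb R^X: f(x)+f(y)\ge d(x,y)\ \forall x,y\}$, ordered pointwise; $\mathrm{E}(X)$ is its set of minimal elements, with metric $\|f-g\|_\infty$. $A(f)$ is the set of unordered pairs $\{x,y\}$ ($x=y$ allowed) with $f(x)+f(y)=d(x,y)$; $\mathrm{E}'(X)=\{f\in\Delta(X):\bigcup A(f)=X\}$; $\mathscr A(X)=\{A(f):f\in\mathrm E'(X)\}$; $H(A)=\{g\in\mathbb R^X: g(x)+g(y)=d(x,y)\ \forall\{x,y\}\in A\}$, $\mathrm{rk}(A)=\dim H(A)$, $P(A)=\mathrm E'(X)\cap H(A)$. A polyhedral structure on a set is a family of polytopes (cells, each in a finite-dimensional affine subspace, metrized by the sup norm) covering it, such that faces of cells are cells and the intersection of two cells is empty or a common face. $X$ is discretely path-connected if any $x,y\in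 X$ are joined by a sequence $x=\gamma(0),\dots,\gamma(l)=y$ with $d(\gamma(k-1),\gamma(k))=1$. *)

theory Defs
  imports "HOL-Analysis.Analysis"
begin

text \<open>
  Setting: a metric space given by a carrier set X :: 'a set and a metric d on X.
  Real-valued functions on X (elements of R^X) are represented by functions
  'a => real that vanish outside X (extensional functions).
\<close>

definition metric_on :: "'a set \<Rightarrow> ('a \<Rightarrow> 'a \<Rightarrow> real) \<Rightarrow> bool" where
  "metric_on X d \<longleftrightarrow>
     (\<forall>x\<in>X. \<forall>y\<in>X. d x y = 0 \<longleftrightarrow> x = y) \<and>
     (\<forall>x\<in>X. \<forall>y\<in>X. d x y = d y x) \<and>
     (\<forall>x\<in>X. \<forall>y\<in>X. \<forall>z\<in>X. d x z \<le> d x y + d y z)"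

definition int_valued :: "'a set \<Rightarrow> ('a \<Rightarrow> 'a \<Rightarrow> real) \<Rightarrow> bool" where
  "int_valued X d \<longleftrightarrow> (\<forall>x\<in>X. \<forall>y\<in>X. d x y \<in> \<int>)"

definition RX :: "'a set \<Rightarrow> ('a \<Rightarrow> real) set" where
  "RX X = {f. \<forall>x. x \<notin> X \<longrightarrow> f x = 0}"

definition Delta :: "'a set \<Rightarrow> ('a \<Rightarrow> 'a \<Rightarrow> real) \<Rightarrow> ('a \<Rightarrow> real) set" where
  "Delta X d = {f \<in> RX X. \<forall>x\<in>X. \<forall>y\<in>X. f x + f y \<ge> d x y}"

definition Ehull :: "'a set \<Rightarrow> ('a \<Rightarrow> 'a \<Rightarrow> real) \<Rightarrow> ('a \<Rightarrow> real) set" where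
  "Ehull X d = {f \<in> Delta X d. \<forall>g\<in>Delta X d. (\<forall>x\<in>X. g x \<le> f x) \<longrightarrow> g = f}"

definition Apairs :: "'a set \<Rightarrow> ('a \<Rightarrow> 'a \<Rightarrow> real) \<Rightarrow> ('a \<Rightarrow> real) \<Rightarrow> 'a set set" where
  "Apairs X d f = {{x, y} | x y. x \<in> X \<and> y \<in> X \<and> f x + f y = d x y}"

definition Eprime :: "'a set \<Rightarrow> ('a \<Rightarrow> 'a \<Rightarrow> real) \<Rightarrow> ('a \<Rightarrow> real) set" where
  "Eprime X d = {f \<in> Delta X d. \<Union>(Apairs X d f) = X}"

definition Afam :: "'a set \<Rightarrow> ('a \<Rightarrow> 'a \<Rightarrow> real) \<Rightarrow> 'a set set set" where
  "Afam X d = Apairs X d ` Eprime X d"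

definition Hsp :: "'a set \<Rightarrow> ('a \<Rightarrow> 'a \<Rightarrow> real) \<Rightarrow> 'a set set \<Rightarrow> ('a \<Rightarrow> real) set" where
  "Hsp X d A = {g \<in> RX X. \<forall>x y. {x, y} \<in> A \<longrightarrow> g x + g y = d x y}"

definition Pcell :: "'a set \<Rightarrow> ('a \<Rightarrow> 'a \<Rightarrow> real) \<Rightarrow> 'a set set \<Rightarrow> ('a \<Rightarrow> real) set" where
  "Pcell X d A = Eprime X d \<inter> Hsp X d A"

text \<open>Sup-norm distance (as an extended real, so that it is never a junk value).\<close>
definition supdist :: "'a set \<Rightarrow> ('a \<Rightarrow> real) \<Rightarrow> ('a \<Rightarrow> real) \<Rightarrow> ereal" where
  "supdist X f g = (SUP x\<in>X. ereal \<bar>f x - g x\<bar>)"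

definition lin_indep :: "('a \<Rightarrow> real) set \<Rightarrow> bool" where
  "lin_indep V \<longleftrightarrow> finite V \<and>
     (\<forall>c. (\<forall>x. (\<Sum>v\<in>V. c v * v x) = 0) \<longrightarrow> (\<forall>v\<in>V. c v = 0))"

definition adim :: "('a \<Rightarrow> real) set \<Rightarrow> enat" where
  "adim S = (SUP n \<in> {n. \<exists>p\<in>S. \<exists>V. lin_indep V \<and> card V = n \<and>
                             V \<subseteq> {(\<lambda>x. q x - p x) | q. q \<in> S}}. enat n)"

definition rk :: "'a set \<Rightarrow> ('a \<Rightarrow> 'a \<Rightarrow> real) \<Rightarrow> 'a set set \<Rightarrow> enat" where
  "rk X d A = adim (Hsp X d A)"

definition convex_hull_fun :: "('a \<Rightarrow> real) set \<Rightarrow> ('a \<Rightarrow> real) set" where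
  "convex_hull_fun V = {(\<lambda>x. \<Sum>v\<in>V. c v * v x) | c.
                           (\<forall>v\<in>V. c v \<ge> 0) \<and> (\<Sum>v\<in>V. c v) = 1}"

definition polytope_fun :: "('a \<Rightarrow> real) set \<Rightarrow> bool" where
  "polytope_fun C \<longleftrightarrow> (\<exists>V. finite V \<and> V \<noteq> {} \<and> C = convex_hull_fun V)"

definition convex_fun :: "('a \<Rightarrow> real) set \<Rightarrow> bool" where
  "convex_fun S \<longleftrightarrow> (\<forall>a\<in>S. \<forall>b\<in>S. \<forall>t::real. 0 \<le> t \<and> t \<le> 1 \<longrightarrow>
                         (\<lambda>x. (1 - t) * a x + t * b x) \<in> S)"

definition open_segment_fun :: "('a \<Rightarrow> real) \<Rightarrow> ('a \<Rightarrow> real) \<Rightarrow> ('a \<Rightarrow> real) set" where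
  "open_segment_fun a b =
     (if a = b then {} else {(\<lambda>x. (1 - t) * a x + t * b x) | t::real. 0 < t \<and> t < 1})"

text \<open>Faces of a convex set (as in the library's face_of), here required nonempty.\<close>
definition face_fun :: "('a \<Rightarrow> real) set \<Rightarrow> ('a \<Rightarrow> real) set \<Rightarrow> bool" where
  "face_fun F C \<longleftrightarrow> F \<noteq> {} \<and> F \<subseteq> C \<and> convex_fun F \<and>
     (\<forall>a\<in>C. \<forall>b\<in>C. \<forall>z\<in>F. z \<in> open_segment_fun a b \<longrightarrow> a \<in> F \<and> b \<in> F)"

definition polyhedral_structure :: "('a \<Rightarrow> real) set set \<Rightarrow> ('a \<Rightarrow> real) set \<Rightarrow> bool" where
  "polyhedral_structure \<P> Y \<longleftrightarrow>
     \<Union>\<P> = Y \<and>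
     (\<forall>C\<in>\<P>. polytope_fun C) \<and>
     (\<forall>C\<in>\<P>. \<forall>F. face_fun F C \<longrightarrow> F \<in> \<P>) \<and>
     (\<forall>C\<in>\<P>. \<forall>C'\<in>\<P>. C \<inter> C' = {} \<or> (face_fun (C \<inter> C') C \<and> face_fun (C \<inter> C') C'))"

definition locally_finite_dim ::
  "'a set \<Rightarrow> ('a \<Rightarrow> real) set set \<Rightarrow> ('a \<Rightarrow> real) set \<Rightarrow> bool" where
  "locally_finite_dim X \<P> Y \<longleftrightarrow>
     (\<forall>f\<in>Y. \<exists>\<epsilon>>0. \<exists>N::nat. \<forall>C\<in>\<P>.
        (\<exists>g\<in>C. supdist X f g < ereal \<epsilon>) \<longrightarrow> adim C \<le> enat N)"

definition isometric_cells :: "'a set \<Rightarrow> ('a \<Rightarrow> real) set \<Rightarrow> ('a \<Rightarrow> real) set \<Rightarrow> bool" where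
  "isometric_cells X C C' \<longleftrightarrow>
     (\<exists>\<phi>. bij_betw \<phi> C C' \<and> (\<forall>u\<in>C. \<forall>v\<in>C. supdist X (\<phi> u) (\<phi> v) = supdist X u v))"

definition finitely_many_isometry_types :: "'a set \<Rightarrow> ('a \<Rightarrow> real) set set \<Rightarrow> bool" where
  "finitely_many_isometry_types X \<C> \<longleftrightarrow>
     (\<exists>T. finite T \<and> T \<subseteq> \<C> \<and> (\<forall>C\<in>\<C>. \<exists>C'\<in>T. isometric_cells X C C'))"

definition n_cells :: "('a \<Rightarrow> real) set set \<Rightarrow> nat \<Rightarrow> ('a \<Rightarrow> real) set set" where
  "n_cells \<P> n = {C \<in> \<P>. adim C = enat n}"

definition diam_le :: "'a set \<Rightarrow> ('a \<Rightarrow> real) set \<Rightarrow> real \<Rightarrow> bool" where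
  "diam_le X C D \<longleftrightarrow> (\<forall>u\<in>C. \<forall>v\<in>C. supdist X u v \<le> ereal D)"

definition discretely_path_connected :: "'a set \<Rightarrow> ('a \<Rightarrow> 'a \<Rightarrow> real) \<Rightarrow> bool" where
  "discretely_path_connected X d \<longleftrightarrow>
     (\<forall>x\<in>X. \<forall>y\<in>X. \<exists>\<gamma> :: nat \<Rightarrow> 'a. \<exists>l. \<gamma> 0 = x \<and> \<gamma> l = y \<and>
        (\<forall>k\<le>l. \<gamma> k \<in> X) \<and> (\<forall>k\<in>{1..l}. d (\<gamma> (k - 1)) (\<gamma> k) = 1))"

end

theory Submission
  imports Defs
begin

text \<open>
  Write \<open>L(A)\<close> for the space of functions \<open>w\<close> with \<open>w x + w y = 0\<close>
  for all \<open>{x, y} \<in> A\<close>, the direction space of \<open>H(A)\<close>. If \<open>g \<in> E'(X)\<close>,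
  tight pairs have integral distance, so for each \<open>t\<close> with \<open>2 t\<close> not an integer the function that is
  1 where \<open>g \<equiv> t\<close> modulo 1 and \<open>- 1\<close> where \<open>g \<equiv> - t\<close> lies in \<open>L(A(g))\<close>.
  Hence a bound on the rank bounds the number of values of \<open>g\<close> modulo 1. Elements of
  \<open>E(X)\<close> are uniform limits of elements of \<open>E'(X)\<close> (minimal elements among the functions with values
  in \<open>1 / (2 m)\<close> times the integers), so by local boundedness of the rank they have finitely many values
  modulo 1 as well; the slacks \<open>f x + f y - d x y\<close> are then discrete, so that the infimum 0 over \<open>y\<close>
  is attained and \<open>E(X) = E'(X)\<close>.

  Discreteness of the slacks also makes every \<open>f\<close> a relatively interior point of \<open>P(A(f))\<close>. Moving along
  a line inside a cell until a new pair becomes tight, and using that a cell contains only finitely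
  many different tight sets, one finds that a cell is the convex hull of its finitely many points with
  trivial \<open>L\<close>. These vertices are half-integral, and elements of \<open>L(A)\<close> factor
  through boundedly many types of points; so up to isometry a cell is determined by finitely many
  half-integral constants, and a bound on the diameter leaves finitely many choices.
\<close>

section \<open>Direction spaces of \<open>Hsp\<close>: independence, values and types\<close>

definition Lsp :: "'a set \<Rightarrow> 'a set set \<Rightarrow> ('a \<Rightarrow> real) set" where
  "Lsp X A = {w \<in> RX X. \<forall>x y. {x, y} \<in> A \<longrightarrow> w x + w y = 0}"

text \<open>Counting independent families expresses a dimension bound before \<open>Lsp\<close> is
  known to be finite-dimensional.\<close>

definition Lsp_dim_le :: "'a set \<Rightarrow> 'a set set \<Rightarrow> nat \<Rightarrow> bool" where
  "Lsp_dim_le X A N \<longleftrightarrow> (\<forall>V. lin_indep V \<longrightarrow> V \<subseteq> Lsp X A \<longrightarrow> card V \<le> N)"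

text \<open>Evaluating a vanishing combination at a point where only \<open>v\<close> is nonzero
  isolates the coefficient of \<open>v\<close>.\<close>

lemma lin_indep_dual_points:
  assumes "finite V" and dual: "\<And>v. v \<in> V \<Longrightarrow> \<exists>x. v x \<noteq> 0 \<and> (\<forall>u\<in>V. u \<noteq> v \<longrightarrow> u x = 0)"
  shows "lin_indep V"
  unfolding lin_indep_def
proof (intro conjI allI impI ballI)
  fix c v assume c: "\<forall>x. (\<Sum>v\<in>V. c v * v x) = 0" and v: "v \<in> V"
  obtain x where x: "v x \<noteq> 0" "\<forall>u\<in>V. u \<noteq> v \<longrightarrow> u x = 0" using dual[OF v] by blast
  have "(\<Sum>u\<in>V. c u * u x) = c v * v x + (\<Sum>u\<in>V - {v}. c u * u x)"
    using assms(1) v by (simp add: sum.remove)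
  also have "(\<Sum>u\<in>V - {v}. c u * u x) = 0" using x by (intro sum.neutral) auto
  finally show "c v = 0" using c x by simp
qed fact

lemma lin_indep_scale:
  assumes V: "lin_indep V" and e: "e \<noteq> 0"
  shows "lin_indep ((\<lambda>v x. e * v x) ` V)" "card ((\<lambda>v x. e * v x) ` V) = card V"
proof -
  have inj: "inj_on (\<lambda>v x. e * v x) V"
    using e by (auto simp: inj_on_def fun_eq_iff)
  show "card ((\<lambda>v x. e * v x) ` V) = card V" using inj by (rule card_image)
  show "lin_indep ((\<lambda>v x. e * v x) ` V)"
    unfolding lin_indep_def
  proof (intro conjI allI impI)
    show "finite ((\<lambda>v x. e * v x) ` V)" using V by (simp add: lin_indep_def)
    fix c assume c: "\<forall>x. (\<Sum>v\<in>(\<lambda>v x. e * v x) ` V. c v * v x) = 0"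
    have "\<forall>x. (\<Sum>v\<in>V. (e * c (\<lambda>x. e * v x)) * v x) = 0"
      using c by (simp add: sum.reindex[OF inj] mult_ac)
    then have "\<forall>v\<in>V. e * c (\<lambda>x. e * v x) = 0"
      using V[unfolded lin_indep_def, THEN conjunct2, rule_format, of "\<lambda>v. e * c (\<lambda>x. e * v x)"] by blast
    then show "\<forall>v\<in>(\<lambda>v x. e * v x) ` V. c v = 0" using e by auto
  qed
qed

lemma adim_le_iff:
  "adim S \<le> enat N \<longleftrightarrow>
    (\<forall>p\<in>S. \<forall>V. lin_indep V \<longrightarrow> V \<subseteq> {(\<lambda>x. q x - p x) | q. q \<in> S} \<longrightarrow> card V \<le> N)"
  unfolding adim_def by (auto simp: SUP_le_iff)

lemma adim_mono: "S \<subseteq> T \<Longrightarrow> adim S \<le> adim T"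
  unfolding adim_def by (rule SUP_subset_mono) blast+

lemma Hsp_diff:
  assumes "p \<in> Hsp X d A"
  shows "{(\<lambda>x. q x - p x) | q. q \<in> Hsp X d A} = Lsp X A"
proof (rule set_eqI, rule iffI)
  fix w assume w: "w \<in> Lsp X A"
  have "(p x + w x) + (p y + w y) = d x y" if "{x, y} \<in> A" for x y
  proof -
    have "p x + p y = d x y" "w x + w y = 0" using assms w that by (auto simp: Hsp_def Lsp_def)
    then show ?thesis by simp
  qed
  then have "(\<lambda>x. p x + w x) \<in> Hsp X d A"
    using assms w by (auto simp: Hsp_def Lsp_def RX_def)
  moreover have "w = (\<lambda>x. (p x + w x) - p x)" by auto
  ultimately show "w \<in> {(\<lambda>x. q x - p x) | q. q \<in> Hsp X d A}"
    by (intro CollectI exI[of _ "\<lambda>x. p x + w x"] conjI)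
next
  fix w assume "w \<in> {(\<lambda>x. q x - p x) | q. q \<in> Hsp X d A}"
  then obtain q where q: "w = (\<lambda>x. q x - p x)" "q \<in> Hsp X d A" by blast
  have "w x + w y = 0" if "{x, y} \<in> A" for x y
  proof -
    have "q x + q y = d x y" "p x + p y = d x y" using q assms that by (auto simp: Hsp_def)
    then show ?thesis using q(1) by simp
  qed
  then show "w \<in> Lsp X A" using q assms by (auto simp: Hsp_def Lsp_def RX_def)
qed

text \<open>\<open>adim\<close> ranges over all base points, but for each of them the differences
  within \<open>Hsp\<close> form the same linear space \<open>Lsp\<close>.\<close>

lemma rk_le_iff:
  assumes "p \<in> Hsp X d A"
  shows "rk X d A \<le> enat N \<longleftrightarrow> Lsp_dim_le X A N"
  unfolding rk_def adim_le_iff Lsp_dim_le_def using assms by (auto simp: Hsp_diff)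

text \<open>If tight pairs are exchanged by an involution on the labels, then
  each label that is not fixed yields a vector of \<open>Lsp\<close>, supported on that label and its image.\<close>
lemma card_labels_le:
  fixes h :: "'a \<Rightarrow> 'k"
  assumes dim: "Lsp_dim_le X A N"
    and edge: "\<And>x y. {x, y} \<in> A \<Longrightarrow> h y = \<iota> (h x)"
    and sub: "\<Union>A \<subseteq> X"
    and inv: "\<And>x. x \<in> X \<Longrightarrow> \<iota> (\<iota> (h x)) = h x"
    and R: "R \<subseteq> h ` X" and anti: "\<And>k k'. k \<in> R \<Longrightarrow> k' \<in> R \<Longrightarrow> k' \<noteq> \<iota> k"
  shows "finite R \<and> card R \<le> N"
proof -
  define e where "e k x = (if x \<in> X \<and> h x = k then 1 else 0) - (if x \<in> X \<and> h x = \<iota> k then 1 else (0::real))" for k x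
  have eL: "e k \<in> Lsp X A" if "k \<in> R" for k
  proof -
    have "e k x + e k y = 0" if "{x, y} \<in> A" for x y
    proof -
      have X: "x \<in> X" "y \<in> X" using sub that by auto
      have xy: "h y = \<iota> (h x)" "h x = \<iota> (h y)" using edge[of x y] edge[of y x] that by (simp_all add: insert_commute)
      have "\<iota> (\<iota> k) = k" using inv R \<open>k \<in> R\<close> by auto
      then have "h y = k \<longleftrightarrow> h x = \<iota> k" "h x = k \<longleftrightarrow> h y = \<iota> k" using xy by metis+
      then show ?thesis using X by (simp add: e_def)
    qed
    then show ?thesis by (auto simp: Lsp_def RX_def e_def)
  qed
  have ev: "\<exists>x. \<forall>k'\<in>R. e k' x = (if k' = k then 1 else 0)" if k: "k \<in> R" for k
  proof -
    obtain x where x: "x \<in> X" "h x = k" using k R by blast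
    \<comment> \<open>\<open>anti\<close> rules out that the label \<open>k\<close> of
      \<open>x\<close> is the image of \<open>k'\<close>.\<close>
    have "e k' x = (if k' = k then 1 else 0)" if "k' \<in> R" for k'
      using anti[OF that k] x by (auto simp: e_def)
    then show ?thesis by blast
  qed
  have inj: "inj_on e R"
  proof (rule inj_onI)
    fix k k' assume "k \<in> R" "k' \<in> R" "e k = e k'"
    then show "k = k'" using ev[of k] by (metis zero_neq_one)
  qed
  \<comment> \<open>\<open>R\<close> is not yet known to be finite, so the bound is shown for its
    finite subsets.\<close>
  have "card F \<le> N" if F: "F \<subseteq> R" "finite F" for F
  proof -
    have "lin_indep (e ` F)"
    proof (rule lin_indep_dual_points)
      fix v assume "v \<in> e ` F"
      then obtain k where k: "k \<in> F" "v = e k" by blast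
      obtain x where x: "\<forall>k'\<in>R. e k' x = (if k' = k then 1 else 0)" using ev k F by blast
      then have "e k x = 1" "\<forall>k'\<in>F. e k' \<noteq> e k \<longrightarrow> e k' x = 0" using k F by auto
      then show "\<exists>x. v x \<noteq> 0 \<and> (\<forall>u\<in>e ` F. u \<noteq> v \<longrightarrow> u x = 0)"
        using k by (intro exI[of _ x]) auto
    qed (use F in simp)
    then have "card (e ` F) \<le> N" using dim eL F unfolding Lsp_dim_le_def by blast
    then show ?thesis using inj F by (metis card_image inj_on_subset)
  qed
  then show ?thesis by (intro finite_if_finite_subsets_card_bdd) blast
qed

text \<open>The order of the reals splits each two-element orbit into a lower and an upper label.
  Neither half contains a label together with its image, so each has at most \<open>N\<close>
  members.\<close>

lemma card_labels_nonfixed_le: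
  fixes h :: "'a \<Rightarrow> real"
  assumes dim: "Lsp_dim_le X A N"
    and edge: "\<And>x y. {x, y} \<in> A \<Longrightarrow> h y = \<iota> (h x)"
    and sub: "\<Union>A \<subseteq> X"
    and inv: "\<And>x. x \<in> X \<Longrightarrow> \<iota> (\<iota> (h x)) = h x"
  shows "finite {k \<in> h ` X. \<iota> k \<noteq> k} \<and> card {k \<in> h ` X. \<iota> k \<noteq> k} \<le> 2 * N"
proof -
  let ?R = "{k \<in> h ` X. k < \<iota> k}" and ?R' = "{k \<in> h ` X. \<iota> k < k}"
  have "finite ?R \<and> card ?R \<le> N"
    by (rule card_labels_le[OF dim edge sub inv]) (use inv in force)+
  moreover have "finite ?R' \<and> card ?R' \<le> N"
    by (rule card_labels_le[OF dim edge sub inv]) (use inv in force)+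
  moreover have "{k \<in> h ` X. \<iota> k \<noteq> k} = ?R \<union> ?R'" by auto
  ultimately show ?thesis using card_Un_le[of ?R ?R'] by auto
qed

text \<open>Labelling points by the values of \<open>w\<close> turns the involution into negation;
  its only fixed point 0 accounts for the extra value.\<close>

lemma Lsp_finite_range:
  assumes dim: "Lsp_dim_le X A N" and sub: "\<Union>A \<subseteq> X" and w: "w \<in> Lsp X A"
  shows "finite (w ` X) \<and> card (w ` X) \<le> 2 * N + 1"
proof -
  have "w y = - w x" if "{x, y} \<in> A" for x y
    using w that by (simp add: Lsp_def add.commute eq_neg_iff_add_eq_0)
  then have *: "finite {k \<in> w ` X. - k \<noteq> k} \<and> card {k \<in> w ` X. - k \<noteq> k} \<le> 2 * N"
    by (intro card_labels_nonfixed_le[OF dim _ sub]) auto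
  have s: "w ` X \<subseteq> insert 0 {k \<in> w ` X. - k \<noteq> k}" by auto
  have "card (w ` X) \<le> card (insert 0 {k \<in> w ` X. - k \<noteq> k})"
    by (rule card_mono[OF _ s]) (use * in simp)
  also have "\<dots> \<le> Suc (card {k \<in> w ` X. - k \<noteq> k})" using * by (simp add: card_insert_if)
  finally show ?thesis using * s by (auto intro: finite_subset[OF s])
qed

text \<open>A maximal independent family \<open>B\<close> determines \<open>Lsp\<close>: points on
  which all members of \<open>B\<close> agree are not separated by any \<open>w\<close>. The type of
  a point encodes the tuple of its values under \<open>B\<close>; each of the at most
  \<open>N\<close> members takes at most \<open>2 * N + 1\<close> values.\<close>

lemma Lsp_types:
  assumes dim: "Lsp_dim_le X A N" and sub: "\<Union>A \<subseteq> X"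
  shows "\<exists>\<tau>::'a \<Rightarrow> nat. \<tau> ` X \<subseteq> {..<(2 * N + 1) ^ N} \<and>
    (\<forall>w\<in>Lsp X A. \<forall>x\<in>X. \<forall>y\<in>X. \<tau> x = \<tau> y \<longrightarrow> w x = w y)"
proof -
  let ?P = "\<lambda>B. lin_indep B \<and> B \<subseteq> Lsp X A"
  have "?P {}" by (simp add: lin_indep_def)
  moreover have "\<forall>B. ?P B \<longrightarrow> card B < Suc N"
    using dim by (simp add: Lsp_dim_le_def less_Suc_eq_le)
  ultimately have "\<exists>B. ?P B \<and> (\<forall>B'. ?P B' \<longrightarrow> card B' \<le> card B)"
    by (rule ex_has_greatest_nat)
  then obtain B where B: "?P B" and mx: "\<And>B'. ?P B' \<Longrightarrow> card B' \<le> card B" by blast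
  have finB: "finite B" and cardB: "card B \<le> N"
    using B dim by (auto simp: lin_indep_def Lsp_dim_le_def)
  have span: "w x = w y" if w: "w \<in> Lsp X A" and eq: "\<forall>b\<in>B. b x = b y" for w x y
  proof (cases "w \<in> B")
    case False
    have "\<not> ?P (insert w B)" using mx[of "insert w B"] False finB by auto
    then have "\<not> lin_indep (insert w B)" using B w by auto
    then obtain c where c: "\<forall>x. (\<Sum>v\<in>insert w B. c v * v x) = 0" and nz: "\<exists>v\<in>insert w B. c v \<noteq> 0"
      using finB unfolding lin_indep_def by blast
    have c': "c w * w x + (\<Sum>v\<in>B. c v * v x) = 0" for x
      using c[rule_format, of x] finB False by simp
    have "c w \<noteq> 0"
    proof
      assume "c w = 0"
      then have "\<forall>x. (\<Sum>v\<in>B. c v * v x) = 0" using c' by simp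
      then have "\<forall>v\<in>B. c v = 0" using B unfolding lin_indep_def by blast
      then show False using nz \<open>c w = 0\<close> by auto
    qed
    moreover have "(\<Sum>v\<in>B. c v * v x) = (\<Sum>v\<in>B. c v * v y)" using eq by (intro sum.cong) auto
    ultimately show ?thesis using c'[of x] c'[of y] by (metis add_right_cancel mult_cancel_left)
  qed (use eq in auto)
  define T where "T x = restrict (\<lambda>b. b x) B" for x
  have TX: "T ` X \<subseteq> PiE B (\<lambda>b. b ` X)" by (auto simp: T_def)
  have fr: "finite (b ` X)" "card (b ` X) \<le> 2 * N + 1" if "b \<in> B" for b
    using Lsp_finite_range[OF dim sub] B that by auto
  have finP: "finite (PiE B (\<lambda>b. b ` X))" using finB fr by (intro finite_PiE) auto
  then have finT: "finite (T ` X)" using TX finite_subset by blast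
  have "card (T ` X) \<le> card (PiE B (\<lambda>b. b ` X))" using card_mono[OF finP TX] .
  also have "\<dots> = (\<Prod>b\<in>B. card (b ` X))" using finB by (rule card_PiE)
  also have "\<dots> \<le> (\<Prod>b\<in>B. 2 * N + 1)" using fr by (intro prod_mono) auto
  also have "\<dots> \<le> (2 * N + 1) ^ N" using cardB by (simp add: power_increasing del: mult_Suc power_Suc)
  finally have cT: "card (T ` X) \<le> (2 * N + 1) ^ N" .
  obtain i where i: "bij_betw i (T ` X) {0..<card (T ` X)}" using ex_bij_betw_finite_nat[OF finT] by blast
  show ?thesis
  proof (intro exI[of _ "i \<circ> T"] conjI ballI impI)
    show "(i \<circ> T) ` X \<subseteq> {..<(2 * N + 1) ^ N}" using i cT unfolding bij_betw_def image_comp[symmetric] by auto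
    fix w x y assume "w \<in> Lsp X A" "x \<in> X" "y \<in> X" "(i \<circ> T) x = (i \<circ> T) y"
    then have "T x = T y" using i by (auto simp: bij_betw_def inj_on_def)
    then have "\<forall>b\<in>B. b x = b y" by (metis T_def restrict_apply')
    then show "w x = w y" using span \<open>w \<in> Lsp X A\<close> by blast
  qed
qed

section \<open>Auxiliary facts on minimal functions, residues modulo 1, hulls, codes and
  walks\<close>

text \<open>Zorn's lemma applies because the values are natural numbers: the pointwise minimum of a
  chain is attained at each point, and of two members attaining it at \<open>x\<close> and at
  \<open>y\<close> the smaller one attains both. Hence the constraints pass to the minimum.\<close>

lemma minimal_nat_fun:
  fixes c :: "'a \<Rightarrow> 'a \<Rightarrow> real" and k0 :: "'a \<Rightarrow> nat"
  assumes "\<And>x y. x \<in> X \<Longrightarrow> y \<in> X \<Longrightarrow> c x y \<le> real (k0 x) + real (k0 y)"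
  shows "\<exists>k. (\<forall>x. k x \<le> k0 x) \<and> (\<forall>x\<in>X. \<forall>y\<in>X. c x y \<le> real (k x) + real (k y)) \<and>
    (\<forall>k'. (\<forall>x\<in>X. \<forall>y\<in>X. c x y \<le> real (k' x) + real (k' y)) \<longrightarrow> (\<forall>x. k' x \<le> k x) \<longrightarrow> k' = k)"
proof -
  define F where "F = {k. (\<forall>x. k x \<le> k0 x) \<and> (\<forall>x\<in>X. \<forall>y\<in>X. c x y \<le> real (k x) + real (k y))}"
  \<comment> \<open>The order is reversed, so that a maximal element for \<open>P\<close> is
    pointwise minimal.\<close>
  define P where "P a b \<longleftrightarrow> (\<forall>x. b x \<le> a x)" for a b :: "'a \<Rightarrow> nat"
  have "\<exists>m\<in>F. \<forall>a\<in>F. P m a \<longrightarrow> a = m"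
  proof (rule predicate_Zorn)
    show "partial_order_on F (relation_of P F)"
      by (rule partial_order_on_relation_ofI) (auto simp: P_def fun_eq_iff intro: order_trans antisym)
    fix C assume C: "C \<in> Chains (relation_of P F)"
    then have CF: "C \<subseteq> F" and tot: "\<And>a b. a \<in> C \<Longrightarrow> b \<in> C \<Longrightarrow> P a b \<or> P b a"
      by (auto simp: Chains_def relation_of_def)
    show "\<exists>u\<in>F. \<forall>a\<in>C. P a u"
    proof (cases "C = {}")
      case True
      then show ?thesis using assms by (intro bexI[of _ k0]) (auto simp: F_def)
    next
      case False
      define u where "u x = (LEAST n. \<exists>a\<in>C. n = a x)" for x
      have att: "\<exists>a\<in>C. u x = a x" for x
        unfolding u_def by (rule LeastI_ex) (use False in blast)
      have le: "u x \<le> a x" if "a \<in> C" for a x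
        unfolding u_def by (rule Least_le) (use that in blast)
      have "u \<in> F"
      proof -
        have "u x \<le> k0 x" for x
          using att[of x] CF by (auto simp: F_def)
        moreover have "c x y \<le> real (u x) + real (u y)" if "x \<in> X" "y \<in> X" for x y
        proof -
          obtain a b where ab: "a \<in> C" "u x = a x" "b \<in> C" "u y = b y" using att by metis
          consider "P a b" | "P b a" using tot ab by blast
          then obtain e where "e \<in> C" "e x \<le> a x" "e y \<le> b y"
            by cases (use ab in \<open>auto simp: P_def\<close>)
          then show ?thesis using ab CF that by (fastforce simp: F_def)
        qed
        ultimately show ?thesis by (simp add: F_def)
      qed
      then show ?thesis using le by (auto simp: P_def)
    qed
  qed
  then obtain m where m: "m \<in> F" "\<And>a. a \<in> F \<Longrightarrow> P m a \<Longrightarrow> a = m" by blast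
  have "k' = m" if "\<forall>x\<in>X. \<forall>y\<in>X. c x y \<le> real (k' x) + real (k' y)" "\<forall>x. k' x \<le> m x" for k'
  proof (rule m(2))
    have "k' x \<le> k0 x" for x
      using that(2)[rule_format, of x] m(1) le_trans unfolding F_def by blast
    then show "k' \<in> F" using that(1) by (simp add: F_def)
    show "P m k'" using that(2) by (simp add: P_def)
  qed
  then show ?thesis using m(1) by (intro exI[of _ m]) (auto simp: F_def)
qed

lemma finite_pos_lower_bound:
  fixes S :: "real set"
  assumes "finite S"
  shows "\<exists>\<delta>>0. \<delta> \<le> 1 \<and> (\<forall>s\<in>S. 0 < s \<longrightarrow> \<delta> \<le> s)"
  using assms by (intro exI[of _ "Min (insert 1 {s \<in> S. 0 < s})"]) auto


lemma frac_eq_if_diff_int: "a = b + of_int i \<Longrightarrow> frac a = frac b"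
  by (simp add: frac_def)

lemma frac_neg_frac: "frac (- frac t) = frac (- t)"
  by (rule frac_eq_if_diff_int[of _ _ "\<lfloor>t\<rfloor>"]) (simp add: frac_def)

text \<open>Fixed points of negation modulo 1: \<open>2 * t\<close> is an integer that is at least 0
  and less than 2.\<close>

lemma frac_neg_eq_self:
  fixes t :: real
  assumes "frac (- t) = t"
  shows "t \<in> {0, 1 / 2}"
proof -
  define j where "j = - \<lfloor>- t\<rfloor>"
  have j: "2 * t = of_int j" using assms by (simp add: frac_def j_def)
  have "0 \<le> t" "t < 1" using assms frac_ge_0[of "- t"] frac_lt_1[of "- t"] by auto
  then have "0 \<le> j" "j < 2" using j by linarith+
  then have "j = 0 \<or> j = 1" by auto
  then show ?thesis using j by auto
qed

text \<open>Finitely many distinct residues of \<open>f\<close> are separated modulo 1 by some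
  \<open>\<delta>\<close>. An approximant within \<open>\<delta> / 3\<close> keeps them distinct, so
  there are at most \<open>M\<close> of them.\<close>

lemma finite_frac_of_uniform_limit:
  fixes f :: "'a \<Rightarrow> real"
  assumes approx: "\<And>e. e > 0 \<Longrightarrow> \<exists>g. (\<forall>x\<in>X. \<bar>f x - g x\<bar> \<le> e) \<and> finite (frac ` g ` X) \<and> card (frac ` g ` X) \<le> M"
  shows "finite (frac ` f ` X)"
proof -
  have "card F \<le> M" if F: "F \<subseteq> frac ` f ` X" "finite F" for F
  proof -
    obtain p where p: "\<And>t. t \<in> F \<Longrightarrow> p t \<in> X \<and> frac (f (p t)) = t" using F(1) by (simp add: subset_iff image_iff) metis
    define S where "S = (\<lambda>(s, t). \<bar>f (p s) - f (p t) - of_int (round (f (p s) - f (p t)))\<bar>) ` (F \<times> F)"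
    have "finite S" using F by (simp add: S_def)
    then obtain \<delta> where \<delta>: "\<delta> > 0" "\<And>s. s \<in> S \<Longrightarrow> 0 < s \<Longrightarrow> \<delta> \<le> s" using finite_pos_lower_bound[of S] by blast
    obtain g where g: "\<forall>x\<in>X. \<bar>f x - g x\<bar> \<le> \<delta> / 3" "finite (frac ` g ` X)" "card (frac ` g ` X) \<le> M"
      using approx[of "\<delta> / 3"] \<delta>(1) by auto
    have "inj_on (\<lambda>t. frac (g (p t))) F"
    proof (rule inj_onI)
      fix s t assume st: "s \<in> F" "t \<in> F" "frac (g (p s)) = frac (g (p t))"
      define r where "r = f (p s) - f (p t)"
      have gi: "g (p s) - g (p t) = of_int (\<lfloor>g (p s)\<rfloor> - \<lfloor>g (p t)\<rfloor>)"
        using st(3) by (simp add: frac_def algebra_simps)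
      have 1: "\<bar>f (p s) - g (p s)\<bar> \<le> \<delta> / 3" "\<bar>f (p t) - g (p t)\<bar> \<le> \<delta> / 3" using g p st by auto
      \<comment> \<open>The values of \<open>g\<close> differ by an integer, which is no closer to
        \<open>r\<close> than the nearest integer is.\<close>
      have "\<bar>r - of_int (round r)\<bar> \<le> \<bar>r - of_int (\<lfloor>g (p s)\<rfloor> - \<lfloor>g (p t)\<rfloor>)\<bar>"
        by (metis abs_minus_commute round_diff_minimal)
      also have "\<dots> < \<delta>" unfolding gi[symmetric] r_def using 1 \<delta>(1) by linarith
      finally have "\<not> \<delta> \<le> \<bar>r - of_int (round r)\<bar>" by simp
      moreover have "\<bar>r - of_int (round r)\<bar> \<in> S" using st by (force simp: S_def r_def)
      ultimately have "r = of_int (round r)" using \<delta>(2) by force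
      then have "f (p s) = f (p t) + of_int (round r)" by (simp add: r_def)
      then have "frac (f (p s)) = frac (f (p t))" by (simp add: frac_def)
      then show "s = t" using p st by auto
    qed
    moreover have "(\<lambda>t. frac (g (p t))) ` F \<subseteq> frac ` g ` X" using p by auto
    ultimately have "card F \<le> card (frac ` g ` X)" using g(2) by (intro card_inj_on_le)
    then show ?thesis using g(3) by simp
  qed
  then have "finite (frac ` f ` X) \<and> card (frac ` f ` X) \<le> M"
    by (intro finite_if_finite_subsets_card_bdd) blast
  then show ?thesis by simp
qed

lemma convex_hull_fun_incl:
  assumes "finite V" "v \<in> V"
  shows "v \<in> convex_hull_fun V"
proof -
  have "v = (\<lambda>x. \<Sum>u\<in>V. (if u = v then 1 else 0) * u x)"
    using assms by (simp add: if_distrib if_distribR cong: if_cong)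
  moreover have "(\<Sum>u\<in>V. if u = v then 1 else 0) = (1::real)" using assms by simp
  moreover have "\<forall>u\<in>V. (if u = v then 1 else 0) \<ge> (0::real)" by simp
  ultimately show ?thesis unfolding convex_hull_fun_def
    by (intro CollectI exI[of _ "\<lambda>u. if u = v then 1 else 0"] conjI)
qed

lemma convex_hull_fun_convex:
  assumes a: "a \<in> convex_hull_fun V" and b: "b \<in> convex_hull_fun V" and t: "0 \<le> t" "t \<le> 1"
  shows "(\<lambda>x. (1 - t) * a x + t * b x) \<in> convex_hull_fun V"
proof -
  obtain c where c: "a = (\<lambda>x. \<Sum>v\<in>V. c v * v x)" "\<forall>v\<in>V. c v \<ge> 0" "(\<Sum>v\<in>V. c v) = 1"
    using a by (auto simp: convex_hull_fun_def)
  obtain c' where c': "b = (\<lambda>x. \<Sum>v\<in>V. c' v * v x)" "\<forall>v\<in>V. c' v \<ge> 0" "(\<Sum>v\<in>V. c' v) = 1"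
    using b by (auto simp: convex_hull_fun_def)
  let ?c = "\<lambda>v. (1 - t) * c v + t * c' v"
  have "(\<lambda>x. (1 - t) * a x + t * b x) = (\<lambda>x. \<Sum>v\<in>V. ?c v * v x)"
    by (simp add: c(1) c'(1) sum_distrib_left sum.distrib distrib_right mult.assoc)
  moreover have "\<forall>v\<in>V. ?c v \<ge> 0" using c(2) c'(2) t by simp
  moreover have "(\<Sum>v\<in>V. ?c v) = 1" using c(3) c'(3) by (simp add: sum.distrib flip: sum_distrib_left)
  ultimately show ?thesis
    unfolding convex_hull_fun_def by (intro CollectI exI[of _ ?c] conjI)
qed

text \<open>The room between \<open>\<epsilon>'\<close> and \<open>\<epsilon>\<close> later allows a
  point to be moved without leaving the neighbourhood.\<close>

lemma supdist_less_imp_bound: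
  assumes "supdist X f g < ereal \<epsilon>"
  obtains \<epsilon>' where "\<epsilon>' < \<epsilon>" "\<And>x. x \<in> X \<Longrightarrow> \<bar>f x - g x\<bar> \<le> \<epsilon>'"
proof -
  obtain \<epsilon>' where \<epsilon>': "supdist X f g < ereal \<epsilon>'" "ereal \<epsilon>' < ereal \<epsilon>"
    using ereal_dense2[OF assms] by blast
  have "\<bar>f x - g x\<bar> \<le> \<epsilon>'" if "x \<in> X" for x
  proof -
    have "ereal \<bar>f x - g x\<bar> \<le> supdist X f g" unfolding supdist_def using that by (rule SUP_upper)
    then have "ereal \<bar>f x - g x\<bar> < ereal \<epsilon>'" using \<epsilon>'(1) by (rule le_less_trans)
    then show ?thesis by simp
  qed
  then show thesis using that \<epsilon>'(2) by simp
qed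

lemma supdist_le_iff: "supdist X f g \<le> ereal c \<longleftrightarrow> (\<forall>x\<in>X. \<bar>f x - g x\<bar> \<le> c)"
  by (simp add: supdist_def SUP_le_iff)

text \<open>One representative is chosen for each code that occurs. Codes are given by a relation,
  since the code of a cell depends on choices.\<close>

lemma finitely_many_isometry_types_by_codes:
  assumes fin: "finite K" and code: "\<And>C. C \<in> \<C> \<Longrightarrow> \<exists>c\<in>K. R C c"
    and iso: "\<And>C C' c. R C c \<Longrightarrow> R C' c \<Longrightarrow> isometric_cells X C C'"
  shows "finitely_many_isometry_types X \<C>"
proof -
  define K' where "K' = {c \<in> K. \<exists>C\<in>\<C>. R C c}"
  define rep where "rep c = (SOME C. C \<in> \<C> \<and> R C c)" for c
  have rep: "rep c \<in> \<C> \<and> R (rep c) c" if "c \<in> K'" for c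
    unfolding rep_def by (rule someI_ex) (use that in \<open>auto simp: K'_def\<close>)
  show ?thesis
    unfolding finitely_many_isometry_types_def
  proof (intro exI[of _ "rep ` K'"] conjI ballI)
    show "finite (rep ` K')" using fin by (simp add: K'_def)
    show "rep ` K' \<subseteq> \<C>" using rep by blast
    fix C assume C: "C \<in> \<C>"
    obtain c where c: "c \<in> K" "R C c" using code[OF C] by blast
    then have "c \<in> K'" using C by (auto simp: K'_def)
    then show "\<exists>C'\<in>rep ` K'. isometric_cells X C C'" using rep iso c(2) by blast
  qed
qed

text \<open>Each of the half-open intervals of length 2 that subdivide the range of the walk
  contains a value: the one after the first crossing of its lower end.\<close>
lemma card_values_of_walk:
  fixes w :: "nat \<Rightarrow> real"
  assumes fin: "finite F" and val: "\<And>k. k \<le> l \<Longrightarrow> w k \<in> F"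
    and step: "\<And>k. k < l \<Longrightarrow> w (Suc k) \<le> w k + 2" and range: "w 0 + 2 * real m \<le> w l"
  shows "m \<le> card F"
proof -
  have ex: "\<exists>v\<in>F. w 0 + 2 * real i < v \<and> v \<le> w 0 + 2 * real i + 2" if i: "i < m" for i
  proof -
    let ?P = "\<lambda>k. k \<le> l \<and> w 0 + 2 * real i < w k"
    have "?P l" using range i by simp
    then have P: "?P (LEAST k. ?P k)" by (rule LeastI)
    define k where "k = (LEAST k. ?P k)"
    have k: "?P k" using P by (simp add: k_def)
    \<comment> \<open>The first crossing is not at index 0, because the lower end of the interval is
      at least \<open>w 0\<close>.\<close>
    obtain j where j: "k = Suc j" using k by (cases k) auto
    have "\<not> ?P j" using not_less_Least[of j ?P] j by (simp add: k_def)
    then have "w j \<le> w 0 + 2 * real i" using k j by simp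
    moreover have "w (Suc j) \<le> w j + 2" using step k j by simp
    ultimately show ?thesis using k val[of k] unfolding j by (intro bexI[of _ "w (Suc j)"]) auto
  qed
  then obtain p where p: "\<And>i. i < m \<Longrightarrow> p i \<in> F \<and> w 0 + 2 * real i < p i \<and> p i \<le> w 0 + 2 * real i + 2"
    by metis
  have "inj_on p {..<m}"
  proof (rule linorder_inj_onI)
    fix i j assume ij: "i < j" "i \<in> {..<m}" "j \<in> {..<m}"
    then have "real i + 1 \<le> real j" by simp
    then show "p i \<noteq> p j" using p[of i] p[of j] ij by auto
  qed auto
  moreover have "p ` {..<m} \<subseteq> F" using p by auto
  ultimately have "card {..<m} \<le> card F" using fin by (intro card_inj_on_le)
  then show ?thesis by simp
qed

section \<open>Tight pairs and minimal functions for an integer valued metric\<close>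

locale int_metric =
  fixes X :: "'a set" and d :: "'a \<Rightarrow> 'a \<Rightarrow> real"
  assumes metric: "metric_on X d" and intval: "int_valued X d"
begin

lemma d_self: "x \<in> X \<Longrightarrow> d x x = 0"
  and d_sym: "x \<in> X \<Longrightarrow> y \<in> X \<Longrightarrow> d x y = d y x"
  and d_tri: "x \<in> X \<Longrightarrow> y \<in> X \<Longrightarrow> z \<in> X \<Longrightarrow> d x z \<le> d x y + d y z"
  using metric unfolding metric_on_def by blast+

lemma d_Ints: "x \<in> X \<Longrightarrow> y \<in> X \<Longrightarrow> d x y \<in> \<int>"
  using intval by (auto simp: int_valued_def)

text \<open>An unordered pair does not fix which point comes first; symmetry of \<open>d\<close>
  makes the condition independent of it.\<close>

lemma pair_in_Apairs: "{x, y} \<in> Apairs X d f \<longleftrightarrow> x \<in> X \<and> y \<in> X \<and> f x + f y = d x y"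
  unfolding Apairs_def by (auto simp: doubleton_eq_iff d_sym add.commute)

lemma Union_Apairs_subset: "\<Union>(Apairs X d f) \<subseteq> X"
  by (auto simp: Apairs_def)

lemma Apairs_subset_iff:
  "Apairs X d f \<subseteq> A \<longleftrightarrow> (\<forall>x\<in>X. \<forall>y\<in>X. f x + f y = d x y \<longrightarrow> {x, y} \<in> A)"
  by (auto simp: Apairs_def)

lemma DeltaD: "f \<in> Delta X d \<Longrightarrow> x \<in> X \<Longrightarrow> y \<in> X \<Longrightarrow> d x y \<le> f x + f y"
  by (auto simp: Delta_def)

lemma Delta_outside: "f \<in> Delta X d \<Longrightarrow> x \<notin> X \<Longrightarrow> f x = 0"
  by (auto simp: Delta_def RX_def)

lemma Delta_nonneg: "f \<in> Delta X d \<Longrightarrow> 0 \<le> f x"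
  using DeltaD[of f x x] d_self[of x] Delta_outside[of f x] by (cases "x \<in> X") auto

lemma Eprime_Delta: "f \<in> Eprime X d \<Longrightarrow> f \<in> Delta X d"
  by (simp add: Eprime_def)

lemma Eprime_iff: "f \<in> Eprime X d \<longleftrightarrow> f \<in> Delta X d \<and> (\<forall>x\<in>X. \<exists>y\<in>X. f x + f y = d x y)"
proof -
  have "\<Union>(Apairs X d f) = {x \<in> X. \<exists>y\<in>X. f x + f y = d x y}"
    by (auto simp: Apairs_def) (metis add.commute d_sym)+
  then show ?thesis by (auto simp: Eprime_def)
qed

lemma Eprime_partner:
  assumes "f \<in> Eprime X d" "x \<in> X"
  obtains y where "y \<in> X" "f x + f y = d x y"
  using assms by (auto simp: Eprime_iff)

text \<open>A tight partner \<open>y\<close> of \<open>x\<close> forces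
  \<open>g x \<ge> d x y - g y \<ge> d x y - f y = f x\<close>.\<close>

lemma Eprime_subset_Ehull: "Eprime X d \<subseteq> Ehull X d"
proof
  fix f assume f: "f \<in> Eprime X d"
  have "g = f" if g: "g \<in> Delta X d" and le: "\<forall>x\<in>X. g x \<le> f x" for g
  proof
    fix x show "g x = f x"
    proof (cases "x \<in> X")
      case True
      obtain y where y: "y \<in> X" "f x + f y = d x y" using Eprime_partner[OF f True] .
      then show ?thesis using DeltaD[OF g True y(1)] le[rule_format, OF True] le[rule_format, OF y(1)] by linarith
    next
      case False
      then show ?thesis using Delta_outside g f Eprime_Delta by metis
    qed
  qed
  then show "f \<in> Ehull X d" using Eprime_Delta[OF f] by (auto simp: Ehull_def)
qed

text \<open>Otherwise the value at \<open>x\<close> could be lowered by \<open>\<delta> / 2\<close>;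
  half of \<open>\<delta>\<close>, because the pair \<open>{x, x}\<close> loses this amount
  twice.\<close>

lemma Ehull_almost_tight:
  assumes f: "f \<in> Ehull X d" and x: "x \<in> X" and \<delta>: "\<delta> > 0"
  shows "\<exists>y\<in>X. f x + f y < d x y + \<delta>"
proof (rule ccontr)
  assume "\<not> ?thesis"
  then have gap: "f x + f y \<ge> d x y + \<delta>" if "y \<in> X" for y using that by force
  have fD: "f \<in> Delta X d" using f by (simp add: Ehull_def)
  define g where "g = f(x := f x - \<delta> / 2)"
  have "d y z \<le> g y + g z" if "y \<in> X" "z \<in> X" for y z
    using DeltaD[OF fD that] gap[OF that(1)] gap[OF that(2)] d_sym[OF that] \<delta>
    by (auto simp: g_def)
  then have "g \<in> Delta X d" using fD x by (auto simp: Delta_def RX_def g_def)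
  moreover have "\<forall>y\<in>X. g y \<le> f y" using \<delta> by (simp add: g_def)
  ultimately have "g = f" using f by (auto simp: Ehull_def)
  then have "g x = f x" by simp
  then show False using \<delta> by (simp add: g_def)
qed

text \<open>\<open>2 * m * f\<close> is rounded up to integers and a minimal admissible integer
  function \<open>k\<close> below it is taken. Integrality turns minimality of \<open>k\<close> into
  tightness, so \<open>k\<close> divided by \<open>2 * m\<close> lies in
  \<open>Eprime\<close>.\<close>

lemma Eprime_dense:
  assumes f: "f \<in> Ehull X d" and e: "e > 0"
  shows "\<exists>g\<in>Eprime X d. \<forall>x\<in>X. \<bar>f x - g x\<bar> \<le> e"
proof -
  have fD: "f \<in> Delta X d" using f by (simp add: Ehull_def)
  obtain m :: nat where m: "m > 0" "inverse (real m) < e" using ex_inverse_of_nat_less[OF e] by blast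
  define k0 where "k0 x = nat \<lceil>2 * m * f x\<rceil>" for x
  have k0: "real (k0 x) \<ge> 2 * m * f x" "real (k0 x) \<le> 2 * m * f x + 1" for x
    using Delta_nonneg[OF fD, of x] by (auto simp: k0_def)
  define c where "c x y = 2 * m * d x y" for x y
  have "c x y \<le> real (k0 x) + real (k0 y)" if "x \<in> X" "y \<in> X" for x y
  proof -
    have "2 * m * d x y \<le> 2 * m * (f x + f y)" using DeltaD[OF fD that] by (intro mult_left_mono) auto
    then show ?thesis using k0(1)[of x] k0(1)[of y] by (simp add: c_def algebra_simps)
  qed
  from minimal_nat_fun[of X c k0, OF this]
  obtain k where k: "\<And>x. k x \<le> k0 x" "\<And>x y. x \<in> X \<Longrightarrow> y \<in> X \<Longrightarrow> c x y \<le> real (k x) + real (k y)"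
    and kmin: "\<And>k'. \<forall>x\<in>X. \<forall>y\<in>X. c x y \<le> real (k' x) + real (k' y) \<Longrightarrow> \<forall>x. k' x \<le> k x \<Longrightarrow> k' = k"
    by blast
  have cInt: "\<exists>i::int. c x y = of_int i" if xy: "x \<in> X" "y \<in> X" for x y
  proof -
    obtain i where "d x y = of_int i" using d_Ints[OF xy] by (auto elim: Ints_cases)
    then have "c x y = of_int (2 * int m * i)" by (simp add: c_def)
    then show ?thesis by blast
  qed
  have tight: "\<exists>y\<in>X. real (k x) + real (k y) = c x y" if x: "x \<in> X" for x
  proof (rule ccontr)
    assume "\<not> ?thesis"
    \<comment> \<open>Both sides of a strict inequality are integers, so they differ by at least
      1.\<close>
    then have lt: "c x y + 1 \<le> real (k x) + real (k y)" if y: "y \<in> X" for y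
    proof -
      obtain i where i: "c x y = of_int i" using cInt x y by blast
      have "c x y < real (k x) + real (k y)"
        using \<open>\<not> (\<exists>y\<in>X. real (k x) + real (k y) = c x y)\<close> y k(2)[OF x y] by force
      then have "i < int (k x) + int (k y)" unfolding i by linarith
      then show ?thesis unfolding i by linarith
    qed
    define k' where "k' = k(x := k x - 1)"
    \<comment> \<open>Positivity makes the subtraction on natural numbers a true decrease.\<close>
    have kx: "k x > 0" using lt[OF x] d_self[OF x] by (simp add: c_def)
    have k'x: "real (k' x) = real (k x) - 1" using kx by (simp add: k'_def)
    have k'y: "y \<noteq> x \<Longrightarrow> k' y = k y" for y by (simp add: k'_def)
    have "c y z \<le> real (k' y) + real (k' z)" if "y \<in> X" "z \<in> X" for y z
    proof (cases "y = x")
      case yx: True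
      show ?thesis
      proof (cases "z = x")
        case True
        \<comment> \<open>The pair \<open>{x, x}\<close> only demands nonnegativity, so lowering
          \<open>k x\<close> cannot violate its constraint.\<close>
        have "c x x = 0" using d_self[OF x] by (simp add: c_def)
        then show ?thesis using True yx by simp
      next
        case False
        then show ?thesis using lt[OF that(2)] yx k'x k'y[of z] by simp
      qed
    next
      case yx: False
      have cs: "c y z = c z y" using d_sym[OF that] by (simp add: c_def)
      show ?thesis
        using lt[OF that(1)] k(2)[OF that] yx k'x k'y[of z] k'y[of y] cs by (cases "z = x") auto
    qed
    then have "k' = k" by (intro kmin) (auto simp: k'_def)
    then show False using k'x by simp
  qed
  define g where "g x = (if x \<in> X then real (k x) / (2 * m) else 0)" for x
  have gk: "2 * m * g x = real (k x)" if "x \<in> X" for x using that m by (simp add: g_def)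
  have "d x y \<le> g x + g y" if "x \<in> X" "y \<in> X" for x y
    using k(2)[OF that] m that by (simp add: c_def g_def field_simps)
  then have gD: "g \<in> Delta X d" by (auto simp: Delta_def RX_def g_def)
  have "\<exists>y\<in>X. g x + g y = d x y" if "x \<in> X" for x
    using tight[OF that] m that by (auto simp: c_def g_def field_simps)
  then have gE: "g \<in> Eprime X d" using gD by (auto simp: Eprime_iff)
  have up: "g x \<le> f x + e / 2" if "x \<in> X" for x
  proof -
    have "2 * m * g x \<le> 2 * m * f x + 1" using k(1)[of x] k0(2)[of x] gk[OF that] by linarith
    then have "g x \<le> f x + inverse (real m) / 2" using m by (simp add: field_simps)
    then show ?thesis using m by linarith
  qed
  have "\<bar>f x - g x\<bar> \<le> e" if x: "x \<in> X" for x
  proof -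
    \<comment> \<open>The lower bound for \<open>g x\<close> follows from the upper bound for
      \<open>g y\<close> at an almost tight partner \<open>y\<close> of \<open>x\<close>.\<close>
    obtain y where y: "y \<in> X" "f x + f y < d x y + e / 2" using Ehull_almost_tight[OF f x, of "e / 2"] e by auto
    then show ?thesis using up[OF x] up[OF y(1)] DeltaD[OF gD x y(1)] e by linarith
  qed
  then show ?thesis using gE by blast
qed

section \<open>Residues modulo 1 and discreteness of the slacks\<close>

text \<open>Tight pairs have integral sums, so residues serve as labels that are exchanged by
  negation modulo 1.\<close>

lemma card_frac_nonfixed:
  assumes g: "g \<in> Eprime X d" and dim: "Lsp_dim_le X (Apairs X d g) N"
  shows "finite {k \<in> frac ` g ` X. frac (- k) \<noteq> k} \<and> card {k \<in> frac ` g ` X. frac (- k) \<noteq> k} \<le> 2 * N"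
proof -
  define h where "h x = frac (g x)" for x
  let ?\<iota> = "\<lambda>t. frac (- t)"
  have "h y = ?\<iota> (h x)" if "{x, y} \<in> Apairs X d g" for x y
  proof -
    have xy: "x \<in> X" "y \<in> X" "g x + g y = d x y" using that by (auto simp: pair_in_Apairs)
    obtain i where i: "d x y = of_int i" using d_Ints[OF xy(1,2)] by (auto elim: Ints_cases)
    have "- h x = g y + of_int (\<lfloor>g x\<rfloor> - i)" using xy i by (simp add: h_def frac_def)
    then have "?\<iota> (h x) = frac (g y)" by (rule frac_eq_if_diff_int)
    then show ?thesis by (simp add: h_def)
  qed
  moreover have "?\<iota> (?\<iota> (h x)) = h x" for x
    by (simp add: h_def frac_neg_frac)
  ultimately have "finite {k \<in> h ` X. ?\<iota> k \<noteq> k} \<and> card {k \<in> h ` X. ?\<iota> k \<noteq> k} \<le> 2 * N"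
    by (intro card_labels_nonfixed_le[OF dim _ Union_Apairs_subset]) auto
  then show ?thesis by (simp add: h_def image_image)
qed

text \<open>The residues fixed by negation, 0 and 1/2, add at most two.\<close>

lemma finite_frac:
  assumes g: "g \<in> Eprime X d" and dim: "Lsp_dim_le X (Apairs X d g) N"
  shows "finite (frac ` g ` X) \<and> card (frac ` g ` X) \<le> 2 * N + 2"
proof -
  let ?R = "{k \<in> frac ` g ` X. frac (- k) \<noteq> k}"
  note * = card_frac_nonfixed[OF g dim]
  have s: "frac ` g ` X \<subseteq> ?R \<union> {0, 1 / 2}"
    using frac_neg_eq_self by blast
  have "card (frac ` g ` X) \<le> card (?R \<union> {0, 1 / 2})"
    by (rule card_mono[OF _ s]) (use * in simp)
  also have "\<dots> \<le> card ?R + card {0, 1 / 2 :: real}" by (rule card_Un_le)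
  also have "\<dots> \<le> 2 * N + 2" using * by simp
  finally show ?thesis using finite_subset[OF s] * by auto
qed

text \<open>Dimension bound 0 leaves no residue that negation moves.\<close>

lemma half_integral_if_Lsp_trivial:
  assumes g: "g \<in> Eprime X d" and L: "Lsp X (Apairs X d g) \<subseteq> {\<lambda>x. 0}" and x: "x \<in> X"
  shows "2 * g x \<in> \<int>"
proof -
  have "Lsp_dim_le X (Apairs X d g) 0"
    unfolding Lsp_dim_le_def
  proof (intro allI impI)
    fix V assume V: "lin_indep V" "V \<subseteq> Lsp X (Apairs X d g)"
    have "V = {}"
    proof (rule ccontr)
      assume "V \<noteq> {}"
      then have "V = {\<lambda>x. 0}" using V(2) L by blast
      then show False using V(1)[unfolded lin_indep_def, THEN conjunct2, rule_format, of "\<lambda>v. 1"] by simp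
    qed
    then show "card V \<le> 0" by simp
  qed
  from card_frac_nonfixed[OF g this] have "{k \<in> frac ` g ` X. frac (- k) \<noteq> k} = {}"
    by (metis (no_types, lifting) card_0_eq le_zero_eq mult_0_right)
  then have "frac (- frac (g x)) = frac (g x)" using x by blast
  then have "frac (g x) \<in> {0, 1 / 2}" by (rule frac_neg_eq_self)
  then have "2 * g x = of_int (2 * \<lfloor>g x\<rfloor>) \<or> 2 * g x = of_int (2 * \<lfloor>g x\<rfloor> + 1)"
    by (auto simp: frac_def)
  then show ?thesis by (metis Ints_of_int)
qed

text \<open>Modulo 1 the slack is a sum of two of the finitely many residues. A positive slack is at
  least 1 if it is integral, and otherwise at least the smallest positive residue of such
  sums.\<close>

lemma gap:
  assumes "finite (frac ` f ` X)"
  shows "\<exists>\<delta>>0. \<forall>x\<in>X. \<forall>y\<in>X. d x y < f x + f y \<longrightarrow> d x y + \<delta> \<le> f x + f y"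
proof -
  let ?S = "(\<lambda>(a, b). frac (a + b)) ` (frac ` f ` X \<times> frac ` f ` X)"
  have "finite ?S" using assms by simp
  then obtain \<delta> where \<delta>: "\<delta> > 0" "\<delta> \<le> 1" "\<And>s. s \<in> ?S \<Longrightarrow> 0 < s \<Longrightarrow> \<delta> \<le> s"
    using finite_pos_lower_bound[of ?S] by blast
  have "d x y + \<delta> \<le> f x + f y" if xy: "x \<in> X" "y \<in> X" and lt: "d x y < f x + f y" for x y
  proof -
    obtain i where i: "d x y = of_int i" using d_Ints[OF xy(1,2)] by (auto elim: Ints_cases)
    define r where "r = f x + f y - d x y"
    have r: "r > 0" using lt by (simp add: r_def)
    have "frac (f x) + frac (f y) = r + of_int (i - \<lfloor>f x\<rfloor> - \<lfloor>f y\<rfloor>)" by (simp add: r_def i frac_def)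
    then have "frac (frac (f x) + frac (f y)) = frac r" by (rule frac_eq_if_diff_int)
    moreover have "frac (frac (f x) + frac (f y)) \<in> ?S"
      using xy by (intro image_eqI[of _ _ "(frac (f x), frac (f y))"]) auto
    ultimately have S: "frac r \<in> ?S" by simp
    have "\<delta> \<le> r"
    proof (cases "frac r = 0")
      case True
      then have "r \<in> \<int>" by simp
      then have "r \<ge> 1" using r by (auto elim!: Ints_cases)
      then show ?thesis using \<delta> by simp
    next
      case False
      then have "\<delta> \<le> frac r" using \<delta>(3)[OF S] frac_ge_0[of r] by simp
      also have "frac r \<le> r" using r by (simp add: frac_def)
      finally show ?thesis .
    qed
    then show ?thesis by (simp add: r_def)
  qed
  then show ?thesis using \<delta>(1) by blast
qed

text \<open>Minimality provides partners with slack below the gap, and such a slack is 0.\<close>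

lemma Ehull_Eprime_if_finite_frac:
  assumes f: "f \<in> Ehull X d" and fin: "finite (frac ` f ` X)"
  shows "f \<in> Eprime X d"
proof -
  have fD: "f \<in> Delta X d" using f by (simp add: Ehull_def)
  obtain \<delta> where \<delta>: "\<delta> > 0" "\<And>x y. x \<in> X \<Longrightarrow> y \<in> X \<Longrightarrow> d x y < f x + f y \<Longrightarrow> d x y + \<delta> \<le> f x + f y"
    using gap[OF fin] by blast
  have "\<exists>y\<in>X. f x + f y = d x y" if x: "x \<in> X" for x
  proof -
    obtain y where y: "y \<in> X" "f x + f y < d x y + \<delta>" using Ehull_almost_tight[OF f x \<delta>(1)] by blast
    then show ?thesis using \<delta>(2)[OF x y(1)] DeltaD[OF fD x y(1)] by force
  qed
  then show ?thesis using fD by (simp add: Eprime_iff)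
qed

text \<open>With a tight partner \<open>z\<close> of \<open>x\<close>, the triangle inequality gives
  \<open>f x = d x z - f z \<le> d x y + d y z - f z \<le> d x y + f y\<close>.\<close>

lemma Eprime_lipschitz:
  assumes f: "f \<in> Eprime X d" and x: "x \<in> X" and y: "y \<in> X"
  shows "f x - f y \<le> d x y"
proof -
  obtain z where z: "z \<in> X" "f x + f z = d x z" using Eprime_partner[OF f x] .
  then show ?thesis using d_tri[OF x y z(1)] DeltaD[OF Eprime_Delta[OF f] y z(1)] by simp
qed

text \<open>For a fixed \<open>z\<close>, \<open>f x \<le> f z + d x z\<close> and
  \<open>d x z \<le> g x + g z\<close> bound \<open>f x - g x\<close> by \<open>f z + g z\<close>,
  although \<open>f\<close> and \<open>g\<close> may be unbounded.\<close>

lemma Eprime_diff_bounded: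
  assumes f: "f \<in> Eprime X d" and g: "g \<in> Eprime X d"
  shows "\<exists>B\<ge>0. \<forall>x\<in>X. \<bar>f x - g x\<bar> \<le> B"
proof (cases "X = {}")
  case False
  then obtain z where z: "z \<in> X" by blast
  have "\<bar>f x - g x\<bar> \<le> f z + g z" if x: "x \<in> X" for x
    using Eprime_lipschitz[OF f x z] Eprime_lipschitz[OF g x z]
      DeltaD[OF Eprime_Delta[OF f] x z] DeltaD[OF Eprime_Delta[OF g] x z] by linarith
  then show ?thesis using Delta_nonneg Eprime_Delta f g by (metis add_nonneg_nonneg)
qed auto


section \<open>Cells, their convexity and their inclusions as faces\<close>

lemma Delta_convex:
  assumes "a \<in> Delta X d" "b \<in> Delta X d" "0 \<le> t" "t \<le> (1::real)"
  shows "(\<lambda>x. (1 - t) * a x + t * b x) \<in> Delta X d"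
proof -
  have "d x y \<le> ((1 - t) * a x + t * b x) + ((1 - t) * a y + t * b y)" if "x \<in> X" "y \<in> X" for x y
  proof -
    have "(1 - t) * d x y + t * d x y \<le> (1 - t) * (a x + a y) + t * (b x + b y)"
      using assms DeltaD that by (intro add_mono mult_left_mono) auto
    then show ?thesis by (simp add: algebra_simps)
  qed
  then show ?thesis
    using Delta_outside[OF assms(1)] Delta_outside[OF assms(2)] by (simp add: Delta_def RX_def)
qed

text \<open>The slack of a proper convex combination is the convex combination of two nonnegative
  slacks, so it vanishes only if both do.\<close>

lemma Apairs_convex:
  assumes a: "a \<in> Delta X d" and b: "b \<in> Delta X d" and t: "0 < t" "t < (1::real)"
  shows "Apairs X d (\<lambda>x. (1 - t) * a x + t * b x) = Apairs X d a \<inter> Apairs X d b"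
proof -
  have "((1 - t) * a x + t * b x) + ((1 - t) * a y + t * b y) = d x y \<longleftrightarrow>
      a x + a y = d x y \<and> b x + b y = d x y" if "x \<in> X" "y \<in> X" for x y
  proof -
    have nn: "(1 - t) * (a x + a y - d x y) \<ge> 0" "t * (b x + b y - d x y) \<ge> 0"
      using DeltaD[OF a that] DeltaD[OF b that] t by auto
    have "((1 - t) * a x + t * b x) + ((1 - t) * a y + t * b y) = d x y \<longleftrightarrow>
      (1 - t) * (a x + a y - d x y) + t * (b x + b y - d x y) = 0" by (auto simp: algebra_simps)
    also have "\<dots> \<longleftrightarrow> a x + a y = d x y \<and> b x + b y = d x y"
      using nn t by (simp add: add_nonneg_eq_0_iff)
    finally show ?thesis .
  qed
  note eq = this
  show ?thesis
  proof (rule set_eqI)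
    fix e
    show "e \<in> Apairs X d (\<lambda>x. (1 - t) * a x + t * b x) \<longleftrightarrow> e \<in> Apairs X d a \<inter> Apairs X d b"
    proof (cases "\<exists>x y. e = {x, y}")
      case True
      then obtain x y where e: "e = {x, y}" by blast
      show ?thesis unfolding e Int_iff pair_in_Apairs using eq[of x y] by blast
    qed (auto simp: Apairs_def)
  qed
qed

lemma Eprime_if_Apairs_subset:
  assumes "f \<in> Eprime X d" "g \<in> Delta X d" "Apairs X d f \<subseteq> Apairs X d g"
  shows "g \<in> Eprime X d"
proof -
  have "X \<subseteq> \<Union>(Apairs X d g)" using assms unfolding Eprime_def by blast
  then show ?thesis using assms(2) Union_Apairs_subset[of g] by (auto simp: Eprime_def)
qed

text \<open>Since \<open>A\<close> covers \<open>X\<close>, membership in \<open>Eprime\<close> is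
  automatic once the pairs of \<open>A\<close> are tight; cells are handled through inclusions of
  tight sets.\<close>

lemma Pcell_iff:
  assumes "A \<in> Afam X d"
  shows "g \<in> Pcell X d A \<longleftrightarrow> g \<in> Delta X d \<and> A \<subseteq> Apairs X d g"
proof -
  obtain f where f: "f \<in> Eprime X d" "A = Apairs X d f" using assms by (auto simp: Afam_def)
  have "g \<in> Hsp X d A \<longleftrightarrow> A \<subseteq> Apairs X d g" if "g \<in> Delta X d"
  proof -
    have "\<exists>x y. e = {x, y}" if "e \<in> A" for e using that f by (auto simp: Apairs_def)
    then have "A \<subseteq> Apairs X d g \<longleftrightarrow> (\<forall>x y. {x, y} \<in> A \<longrightarrow> {x, y} \<in> Apairs X d g)"
      by blast
    then show ?thesis using that f pair_in_Apairs by (auto simp: Hsp_def Delta_def)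
  qed
  then show ?thesis using Eprime_if_Apairs_subset[OF f(1)] f Eprime_Delta by (auto simp: Pcell_def)
qed

lemma Apairs_in_Afam: "f \<in> Eprime X d \<Longrightarrow> Apairs X d f \<in> Afam X d"
  by (simp add: Afam_def)

lemma Pcell_Eprime: "g \<in> Pcell X d A \<Longrightarrow> g \<in> Eprime X d"
  by (simp add: Pcell_def)

lemma self_in_Pcell: "f \<in> Eprime X d \<Longrightarrow> f \<in> Pcell X d (Apairs X d f)"
  by (simp add: Pcell_iff[OF Apairs_in_Afam] Eprime_Delta)

lemma Pcell_diff_in_Lsp:
  assumes "g \<in> Pcell X d A" "h \<in> Pcell X d A"
  shows "(\<lambda>x. h x - g x) \<in> Lsp X A"
proof -
  have gh: "g \<in> Hsp X d A" "h \<in> Hsp X d A" using assms by (simp_all add: Pcell_def)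
  show ?thesis using gh(2) unfolding Hsp_diff[OF gh(1), symmetric] by blast
qed

lemma Lsp_line_in_Pcell:
  assumes f: "f \<in> Eprime X d" and w: "w \<in> Lsp X (Apairs X d f)"
    and D: "(\<lambda>x. f x + s * w x) \<in> Delta X d"
  shows "(\<lambda>x. f x + s * w x) \<in> Pcell X d (Apairs X d f)"
  unfolding Pcell_iff[OF Apairs_in_Afam[OF f]] Apairs_subset_iff
proof (intro conjI ballI impI D)
  fix x y assume xy: "x \<in> X" "y \<in> X" "f x + f y = d x y"
  then have "w x + w y = 0" using w by (simp add: Lsp_def pair_in_Apairs)
  then have "s * w x + s * w y = 0" by (simp flip: distrib_left)
  then show "{x, y} \<in> Apairs X d (\<lambda>x. f x + s * w x)" using xy by (simp add: pair_in_Apairs)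
qed

lemma Pcell_convex:
  assumes A: "A \<in> Afam X d"
  shows "convex_fun (Pcell X d A)"
  unfolding convex_fun_def
proof (intro ballI allI impI)
  fix a b and t :: real assume ab: "a \<in> Pcell X d A" "b \<in> Pcell X d A" and t: "0 \<le> t \<and> t \<le> 1"
  consider "t = 0" | "t = 1" | "0 < t" "t < 1" using t by linarith
  then show "(\<lambda>x. (1 - t) * a x + t * b x) \<in> Pcell X d A"
    by cases (use ab t Delta_convex[of a b t] Apairs_convex[of a b t] in \<open>auto simp: Pcell_iff[OF A]\<close>)
qed

text \<open>A pair that is tight at an inner point of a segment is tight at both ends, which is the
  extremality required of a face.\<close>

lemma Pcell_Int_face:
  assumes A: "A \<in> Afam X d" and A': "A' \<in> Afam X d" and ne: "Pcell X d A \<inter> Pcell X d A' \<noteq> {}"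
  shows "face_fun (Pcell X d A \<inter> Pcell X d A') (Pcell X d A)"
  unfolding face_fun_def
proof (intro conjI ballI impI ne)
  show "convex_fun (Pcell X d A \<inter> Pcell X d A')"
    using Pcell_convex[OF A] Pcell_convex[OF A'] unfolding convex_fun_def by blast
  fix a b z assume ab: "a \<in> Pcell X d A" "b \<in> Pcell X d A" and z: "z \<in> Pcell X d A \<inter> Pcell X d A'"
    and seg: "z \<in> open_segment_fun a b"
  obtain t where t: "0 < t" "t < 1" "z = (\<lambda>x. (1 - t) * a x + t * b x)"
    using seg by (auto simp: open_segment_fun_def split: if_splits)
  have aD: "a \<in> Delta X d" "b \<in> Delta X d" using ab by (auto simp: Pcell_iff[OF A])
  have "A' \<subseteq> Apairs X d a \<inter> Apairs X d b"
    using z Apairs_convex[OF aD t(1,2)] by (simp add: Pcell_iff[OF A'] t(3))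
  then show "a \<in> Pcell X d A \<inter> Pcell X d A'" "b \<in> Pcell X d A \<inter> Pcell X d A'"
    using ab aD by (auto simp: Pcell_iff[OF A'])
qed simp

text \<open>\<open>A'\<close> is the tight set of some \<open>f\<close>, which lies in its own cell,
  so the inclusion of cells tested at \<open>f\<close> returns
  \<open>A \<subseteq> A'\<close>.\<close>

lemma Pcell_antimono_iff:
  assumes A: "A \<in> Afam X d" and A': "A' \<in> Afam X d"
  shows "Pcell X d A' \<subseteq> Pcell X d A \<longleftrightarrow> A \<subseteq> A'"
proof
  assume "A \<subseteq> A'"
  then show "Pcell X d A' \<subseteq> Pcell X d A" using Pcell_iff[OF A] Pcell_iff[OF A'] by blast
next
  obtain f where f: "f \<in> Eprime X d" "A' = Apairs X d f" using A' by (auto simp: Afam_def)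
  assume "Pcell X d A' \<subseteq> Pcell X d A"
  then have "f \<in> Pcell X d A" using self_in_Pcell[OF f(1)] f by auto
  then show "A \<subseteq> A'" by (simp add: Pcell_iff[OF A] f)
qed

lemma Pcell_face_iff:
  assumes A: "A \<in> Afam X d" and A': "A' \<in> Afam X d"
  shows "face_fun (Pcell X d A') (Pcell X d A) \<longleftrightarrow> A \<subseteq> A'"
proof
  assume "face_fun (Pcell X d A') (Pcell X d A)"
  then show "A \<subseteq> A'" using Pcell_antimono_iff[OF A A'] by (simp add: face_fun_def)
next
  assume "A \<subseteq> A'"
  then have "Pcell X d A \<inter> Pcell X d A' = Pcell X d A'" using Pcell_antimono_iff[OF A A'] by blast
  moreover have "Pcell X d A' \<noteq> {}" using A' self_in_Pcell by (auto simp: Afam_def)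
  ultimately show "face_fun (Pcell X d A') (Pcell X d A)" using Pcell_Int_face[OF A A'] by simp
qed

end

section \<open>Relative interiors, faces and boundary points of cells\<close>

text \<open>The bound may depend on \<open>f\<close>; this pointwise form is what the facts about a
  single cell use.\<close>

locale int_metric_locally_finite_rank = int_metric +
  assumes ex_dim: "f \<in> Eprime X d \<Longrightarrow> \<exists>N. Lsp_dim_le X (Apairs X d f) N"
begin

text \<open>Positive slacks are at least \<open>\<delta>\<close>, and \<open>w\<close> is bounded
  because it has finitely many values. A small multiple of \<open>w\<close> thus violates no
  constraint, and tight pairs stay tight.\<close>

lemma interior:
  assumes g: "g \<in> Eprime X d" and w: "w \<in> Lsp X (Apairs X d g)"
  shows "\<exists>\<epsilon>>0. \<forall>s. \<bar>s\<bar> \<le> \<epsilon> \<longrightarrow> (\<lambda>x. g x + s * w x) \<in> Pcell X d (Apairs X d g)"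
proof -
  obtain N where N: "Lsp_dim_le X (Apairs X d g) N" using ex_dim[OF g] by blast
  have gD: "g \<in> Delta X d" using Eprime_Delta[OF g] .
  obtain \<delta> where \<delta>: "\<delta> > 0" "\<And>x y. x \<in> X \<Longrightarrow> y \<in> X \<Longrightarrow> d x y < g x + g y \<Longrightarrow> d x y + \<delta> \<le> g x + g y"
    using gap finite_frac[OF g N] by blast
  have fin: "finite (abs ` w ` X)" using Lsp_finite_range[OF N Union_Apairs_subset w] by simp
  define B0 where "B0 = Max (abs ` w ` X)"
  have B0: "\<bar>w x\<bar> \<le> B0" if "x \<in> X" for x
    unfolding B0_def by (rule Max_ge[OF fin]) (use that in auto)
  \<comment> \<open>The maximum with 1 makes the bound positive, also when \<open>X\<close> is empty
    and \<open>Max\<close> is unspecified.\<close>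
  define B where "B = max B0 1"
  have B: "\<And>x. x \<in> X \<Longrightarrow> \<bar>w x\<bar> \<le> B" "B > 0" using B0 by (force simp: B_def)+
  show ?thesis
  proof (intro exI[of _ "\<delta> / (2 * B)"] conjI allI impI)
    show "\<delta> / (2 * B) > 0" using \<delta> B by simp
    fix s assume s: "\<bar>s\<bar> \<le> \<delta> / (2 * B)"
    have sw: "\<bar>s * w x\<bar> \<le> \<delta> / 2" if "x \<in> X" for x
    proof -
      have "\<bar>s * w x\<bar> \<le> \<delta> / (2 * B) * B" unfolding abs_mult using s B(1)[OF that] by (intro mult_mono) auto
      then show ?thesis using B by simp
    qed
    have "d x y \<le> (g x + s * w x) + (g y + s * w y)" if xy: "x \<in> X" "y \<in> X" for x y
    proof (cases "g x + g y = d x y")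
      case True
      then have "w x + w y = 0" using w xy by (simp add: Lsp_def pair_in_Apairs)
      then have "s * w x + s * w y = 0" by (simp flip: distrib_left)
      then show ?thesis using True by simp
    next
      case False
      then have "d x y + \<delta> \<le> g x + g y" using DeltaD[OF gD xy] by (intro \<delta>(2)[OF xy]) simp
      then show ?thesis using sw[OF xy(1)] sw[OF xy(2)] by linarith
    qed
    then have "(\<lambda>x. g x + s * w x) \<in> Delta X d"
      using Delta_outside[OF gD] w by (auto simp: Delta_def RX_def Lsp_def)
    then show "(\<lambda>x. g x + s * w x) \<in> Pcell X d (Apairs X d g)" by (rule Lsp_line_in_Pcell[OF g w])
  qed
qed

text \<open>Differences within the cell depend only on types. Comparing a pair tight at
  \<open>g\<close> with a pair of the same types tight at \<open>h\<close> shows that the type pairs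
  \<open>S g\<close> determine the tight set, and only finitely many sets of type pairs
  exist.\<close>

lemma finite_Apairs_Pcell:
  assumes A: "A \<in> Afam X d"
  shows "finite (Apairs X d ` Pcell X d A)"
proof -
  obtain f where f: "f \<in> Eprime X d" "A = Apairs X d f" using A by (auto simp: Afam_def)
  obtain N where N: "Lsp_dim_le X A N" using ex_dim[OF f(1)] f by blast
  obtain \<tau> :: "'a \<Rightarrow> nat" where \<tau>: "\<tau> ` X \<subseteq> {..<(2 * N + 1) ^ N}"
    "\<And>w x y. w \<in> Lsp X A \<Longrightarrow> x \<in> X \<Longrightarrow> y \<in> X \<Longrightarrow> \<tau> x = \<tau> y \<Longrightarrow> w x = w y"
    using Lsp_types[OF N Union_Apairs_subset[of f, folded f(2)]] by metis
  define S where "S g = {(\<tau> x, \<tau> y) | x y. {x, y} \<in> Apairs X d g}" for g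
  have "Apairs X d g \<subseteq> Apairs X d h" if g: "g \<in> Pcell X d A" and h: "h \<in> Pcell X d A" and eq: "S g = S h" for g h
    unfolding Apairs_subset_iff
  proof (intro ballI impI)
    fix x y assume xy: "x \<in> X" "y \<in> X" "g x + g y = d x y"
    then have "(\<tau> x, \<tau> y) \<in> S g" by (auto simp: S_def pair_in_Apairs)
    then obtain x' y' where xy': "\<tau> x = \<tau> x'" "\<tau> y = \<tau> y'" "{x', y'} \<in> Apairs X d h"
      unfolding eq by (auto simp: S_def)
    then have X': "x' \<in> X" "y' \<in> X" "h x' + h y' = d x' y'" by (auto simp: pair_in_Apairs)
    have "h x - g x = h x' - g x'" "h y - g y = h y' - g y'"
      using \<tau>(2)[OF Pcell_diff_in_Lsp[OF g h] xy(1) X'(1) xy'(1)]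
        \<tau>(2)[OF Pcell_diff_in_Lsp[OF g h] xy(2) X'(2) xy'(2)] by simp_all
    moreover have "d x' y' \<le> g x' + g y'"
      using DeltaD[OF Eprime_Delta[OF Pcell_Eprime[OF g]] X'(1,2)] .
    moreover have "d x y \<le> h x + h y"
      using DeltaD[OF Eprime_Delta[OF Pcell_Eprime[OF h]] xy(1,2)] .
    ultimately have "h x + h y = d x y" using X'(3) xy(3) by linarith
    then show "{x, y} \<in> Apairs X d h" using xy by (simp add: pair_in_Apairs)
  qed
  then have inj: "Apairs X d g = Apairs X d h" if "g \<in> Pcell X d A" "h \<in> Pcell X d A" "S g = S h" for g h
    using that by (intro subset_antisym) simp_all
  let ?K = "{..<(2 * N + 1) ^ N}"
  have "S ` Pcell X d A \<subseteq> Pow (?K \<times> ?K)"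
    using \<tau>(1) by (force simp: S_def pair_in_Apairs)
  then have "finite (S ` Pcell X d A)" by (rule finite_subset) simp
  moreover have "Apairs X d ` Pcell X d A = (\<lambda>s. Apairs X d (inv_into (Pcell X d A) S s)) ` S ` Pcell X d A"
  proof -
    have "Apairs X d g = Apairs X d (inv_into (Pcell X d A) S (S g))" if "g \<in> Pcell X d A" for g
      using that by (intro inj) (auto intro: inv_into_into simp: f_inv_into_f)
    then show ?thesis by (auto simp: image_image)
  qed
  ultimately show ?thesis by simp
qed

text \<open>Choose \<open>z\<close> in \<open>F\<close> with minimal tight set. Midpoints with
  \<open>z\<close> show that \<open>F\<close> lies in the cell of \<open>z\<close>; conversely
  \<open>z\<close> is relatively interior there, so extremality of \<open>F\<close> captures every
  point of that cell.\<close>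

lemma face_in_cells:
  assumes A: "A \<in> Afam X d" and F: "face_fun F (Pcell X d A)"
  shows "F \<in> Pcell X d ` Afam X d"
proof -
  have ne: "F \<noteq> {}" and sub: "F \<subseteq> Pcell X d A" and conv: "convex_fun F"
    and ext: "\<And>a b z. a \<in> Pcell X d A \<Longrightarrow> b \<in> Pcell X d A \<Longrightarrow> z \<in> F \<Longrightarrow> z \<in> open_segment_fun a b \<Longrightarrow> a \<in> F \<and> b \<in> F"
    using F unfolding face_fun_def by blast+
  have "finite (Apairs X d ` F)" using finite_Apairs_Pcell[OF A] sub by (meson finite_subset image_mono)
  then obtain M where M: "M \<in> Apairs X d ` F" "\<And>B. B \<in> Apairs X d ` F \<Longrightarrow> B \<subseteq> M \<Longrightarrow> M = B"
    using finite_has_minimal[of "Apairs X d ` F"] ne by blast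
  then obtain z where z: "z \<in> F" "M = Apairs X d z" by blast
  have zE: "z \<in> Eprime X d" using z sub Pcell_Eprime by blast
  have FD: "g \<in> Delta X d" if "g \<in> F" for g using that sub Pcell_Eprime Eprime_Delta by blast
  have min: "Apairs X d z \<subseteq> Apairs X d g" if g: "g \<in> F" for g
  proof -
    let ?m = "\<lambda>x. (1 - 1 / 2) * z x + 1 / 2 * g x"
    have "?m \<in> F" using conv z(1) g unfolding convex_fun_def by (elim ballE[of _ _ z] ballE[of _ _ g] allE[of _ "1/2"]) auto
    moreover have "Apairs X d ?m = Apairs X d z \<inter> Apairs X d g"
      using Apairs_convex[OF FD[OF z(1)] FD[OF g], of "1 / 2"] by simp
    ultimately show ?thesis using M(2)[of "Apairs X d ?m"] z(2) by auto
  qed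
  have "F = Pcell X d (Apairs X d z)"
  proof
    show "F \<subseteq> Pcell X d (Apairs X d z)" using min FD by (auto simp: Pcell_iff[OF Apairs_in_Afam[OF zE]])
    show "Pcell X d (Apairs X d z) \<subseteq> F"
    proof
      fix g assume g: "g \<in> Pcell X d (Apairs X d z)"
      have sub': "Pcell X d (Apairs X d z) \<subseteq> Pcell X d A"
        using Pcell_antimono_iff[OF A Apairs_in_Afam[OF zE]] z(1) sub Pcell_iff[OF A] by blast
      show "g \<in> F"
      proof (cases "g = z")
        case False
        obtain \<epsilon> where \<epsilon>: "\<epsilon> > 0" "\<And>s. \<bar>s\<bar> \<le> \<epsilon> \<Longrightarrow> (\<lambda>x. z x + s * (g x - z x)) \<in> Pcell X d (Apairs X d z)"
          using interior[OF zE Pcell_diff_in_Lsp[OF self_in_Pcell[OF zE] g]] by blast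
        \<comment> \<open>\<open>b\<close> lies beyond \<open>z\<close> on the line from
          \<open>g\<close>; the segment from \<open>g\<close> to \<open>b\<close> passes
          \<open>z\<close> at parameter \<open>1 / (1 + \<epsilon>)\<close>.\<close>
        define b where "b = (\<lambda>x. z x + (- \<epsilon>) * (g x - z x))"
        have b: "b \<in> Pcell X d (Apairs X d z)" unfolding b_def using \<epsilon>(1) by (intro \<epsilon>(2)) simp
        obtain x where x: "g x \<noteq> z x" using False by blast
        have "g \<noteq> b"
        proof
          assume "g = b"
          then have "g x = z x - \<epsilon> * (g x - z x)" by (metis b_def minus_mult_left diff_conv_add_uminus)
          then have "(1 + \<epsilon>) * (g x - z x) = 0" by (simp add: algebra_simps)
          then show False using x \<epsilon>(1) by auto
        qed
        moreover have "z = (\<lambda>x. (1 - 1 / (1 + \<epsilon>)) * g x + 1 / (1 + \<epsilon>) * b x)"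
        proof
          fix x
          define k where "k = 1 / (1 + \<epsilon>)"
          have k: "k * (1 + \<epsilon>) = 1" using \<epsilon>(1) by (simp add: k_def)
          have "(1 - k) * g x + k * b x = g x - (k * (1 + \<epsilon>)) * (g x - z x)"
            by (simp add: b_def algebra_simps)
          then show "z x = (1 - 1 / (1 + \<epsilon>)) * g x + 1 / (1 + \<epsilon>) * b x"
            unfolding k by (simp add: k_def)
        qed
        moreover have "0 < 1 / (1 + \<epsilon>)" "1 / (1 + \<epsilon>) < 1" using \<epsilon>(1) by auto
        ultimately have "z \<in> open_segment_fun g b"
          unfolding open_segment_fun_def by (auto intro!: exI[of _ "1 / (1 + \<epsilon>)"])
        then show ?thesis using ext g b sub' z(1) by blast
      qed (use z in simp)
    qed
  qed
  then show ?thesis using Apairs_in_Afam[OF zE] by blast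
qed

text \<open>Move from \<open>g\<close> along \<open>w\<close> as far as \<open>Delta\<close> allows.
  If no new pair were tight at the end, \<open>interior\<close> applied there would permit moving
  further.\<close>

lemma endpoint:
  assumes g: "g \<in> Eprime X d" and w: "w \<in> Lsp X (Apairs X d g)" and nz: "w \<noteq> (\<lambda>x. 0)"
  shows "\<exists>s>0. (\<lambda>x. g x + s * w x) \<in> Pcell X d (Apairs X d g) \<and> Apairs X d g \<subset> Apairs X d (\<lambda>x. g x + s * w x)"
proof -
  have gD: "g \<in> Delta X d" using Eprime_Delta[OF g] .
  define S where "S = {s. (\<lambda>x. g x + s * w x) \<in> Delta X d}"
  have "S = (\<Inter>x\<in>X. \<Inter>y\<in>X. {s. d x y \<le> g x + s * w x + (g y + s * w y)})"
    using w Delta_outside[OF gD] by (auto simp: S_def Delta_def Lsp_def RX_def)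
  moreover have "closed \<dots>"
    by (intro closed_INT ballI closed_Collect_le continuous_intros)
  ultimately have clS: "closed S" by simp
  have S0: "0 \<in> S" using gD by (simp add: S_def)
  obtain x where x: "w x \<noteq> 0" using nz by blast
  then have xX: "x \<in> X" using w by (auto simp: Lsp_def RX_def)
  obtain y where y: "y \<in> X" "g x + g y = d x y" using Eprime_partner[OF g xX] .
  \<comment> \<open>Tight partners carry opposite values, so \<open>w\<close> is negative somewhere;
    nonnegativity on \<open>Delta\<close> then bounds \<open>S\<close> from above.\<close>
  have "w x + w y = 0" using w xX y by (simp add: Lsp_def pair_in_Apairs)
  then obtain z where z: "w z < 0" using x by (metis add_less_same_cancel1 linorder_neqE_linordered_idom add_neg_neg not_less_iff_gr_or_eq add_pos_pos)
  have "s \<le> g z / (- w z)" if "s \<in> S" for s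
  proof -
    have "0 \<le> g z + s * w z" using Delta_nonneg that by (force simp: S_def)
    then show ?thesis using z by (simp add: field_simps)
  qed
  then have bdd: "bdd_above S" by (auto simp: bdd_above_def)
  define s where "s = Sup S"
  have sS: "s \<in> S" unfolding s_def using clS bdd S0 by (intro closed_contains_Sup) auto
  have up: "t \<le> s" if "t \<in> S" for t unfolding s_def using that bdd by (rule cSup_upper)
  obtain \<epsilon> where \<epsilon>: "\<epsilon> > 0" "\<And>s. \<bar>s\<bar> \<le> \<epsilon> \<Longrightarrow> (\<lambda>x. g x + s * w x) \<in> Pcell X d (Apairs X d g)"
    using interior[OF g w] by blast
  have "\<epsilon> \<in> S" using \<epsilon>(2)[of \<epsilon>] \<epsilon>(1) Eprime_Delta Pcell_Eprime by (auto simp: S_def)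
  then have spos: "s > 0" using up \<epsilon>(1) by force
  define e where "e = (\<lambda>x. g x + s * w x)"
  have eC: "e \<in> Pcell X d (Apairs X d g)"
    unfolding e_def using sS by (intro Lsp_line_in_Pcell[OF g w]) (simp add: S_def)
  then have "Apairs X d g \<subseteq> Apairs X d e" by (simp add: Pcell_iff[OF Apairs_in_Afam[OF g]])
  moreover have "Apairs X d g \<noteq> Apairs X d e"
  proof
    assume "Apairs X d g = Apairs X d e"
    then have w': "w \<in> Lsp X (Apairs X d e)" using w by simp
    obtain \<epsilon>' where \<epsilon>': "\<epsilon>' > 0" "\<And>s. \<bar>s\<bar> \<le> \<epsilon>' \<Longrightarrow> (\<lambda>x. e x + s * w x) \<in> Pcell X d (Apairs X d e)"
      using interior[OF Pcell_Eprime[OF eC] w'] by blast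
    have "(\<lambda>x. e x + \<epsilon>' * w x) \<in> Delta X d" using \<epsilon>'(2)[of \<epsilon>'] \<epsilon>'(1) Eprime_Delta Pcell_Eprime by auto
    then have "s + \<epsilon>' \<in> S" by (simp add: S_def e_def algebra_simps)
    then show False using up \<epsilon>'(1) by force
  qed
  ultimately show ?thesis using spos eC unfolding e_def by blast
qed


section \<open>Vertices, and cells as polytopes\<close>

text \<open>These are the extreme points of the cell: by \<open>interior\<close>, a nonzero
  direction would place \<open>v\<close> inside a segment.\<close>

definition vertices :: "'a set set \<Rightarrow> ('a \<Rightarrow> real) set" where
  "vertices A = {v \<in> Pcell X d A. Lsp X (Apairs X d v) \<subseteq> {\<lambda>x. 0}}"

text \<open>Points with equal tight sets differ by an element of \<open>Lsp\<close>, so a vertex is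
  determined by its tight set.\<close>

lemma finite_vertices:
  assumes A: "A \<in> Afam X d"
  shows "finite (vertices A)"
proof -
  have "inj_on (Apairs X d) (vertices A)"
  proof (rule inj_onI)
    fix u v assume uv: "u \<in> vertices A" "v \<in> vertices A" "Apairs X d u = Apairs X d v"
    have "u \<in> Pcell X d (Apairs X d v)"
      using uv self_in_Pcell[of u] Pcell_Eprime by (auto simp: vertices_def)
    moreover have "v \<in> Pcell X d (Apairs X d v)"
      using uv self_in_Pcell[of v] Pcell_Eprime by (auto simp: vertices_def)
    ultimately have "(\<lambda>x. u x - v x) \<in> Lsp X (Apairs X d v)" by (intro Pcell_diff_in_Lsp)
    then have "(\<lambda>x. u x - v x) = (\<lambda>x. 0)" using uv(2) by (auto simp: vertices_def)
    then show "u = v" by (simp add: fun_eq_iff)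
  qed
  moreover have "finite (Apairs X d ` vertices A)"
    using finite_Apairs_Pcell[OF A] by (rule finite_subset[rotated]) (auto simp: vertices_def)
  ultimately show ?thesis by (simp add: finite_image_iff)
qed

text \<open>Induction on the number of strictly larger tight sets in the cell: a point that is no
  vertex lies between the endpoints in directions \<open>w\<close> and \<open>- w\<close>, and both
  have larger tight sets.\<close>

lemma Pcell_subset_hull:
  assumes A: "A \<in> Afam X d" and g: "g \<in> Pcell X d A"
  shows "g \<in> convex_hull_fun (vertices A)"
  using g
proof (induction "card {B \<in> Apairs X d ` Pcell X d A. Apairs X d g \<subset> B}" arbitrary: g rule: less_induct)
  case less
  let ?M = "\<lambda>g. {B \<in> Apairs X d ` Pcell X d A. Apairs X d g \<subset> B}"
  note fin = finite_Apairs_Pcell[OF A]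
  have gE: "g \<in> Eprime X d" using Pcell_Eprime[OF less.prems] .
  have IH: "e \<in> convex_hull_fun (vertices A)"
    if e: "e \<in> Pcell X d (Apairs X d g)" "Apairs X d g \<subset> Apairs X d e" for e
  proof -
    have eA: "e \<in> Pcell X d A"
      using e(1) less.prems Pcell_iff[OF A] Pcell_iff[OF Apairs_in_Afam[OF gE]] by blast
    have "?M e \<subset> ?M g" using e(2) eA by blast
    then have "card (?M e) < card (?M g)" using fin by (intro psubset_card_mono) auto
    then show ?thesis using less.hyps eA by blast
  qed
  show ?case
  proof (cases "Lsp X (Apairs X d g) \<subseteq> {\<lambda>x. 0}")
    case True
    then have "g \<in> vertices A" using less.prems by (simp add: vertices_def)
    then show ?thesis using convex_hull_fun_incl finite_vertices[OF A] by blast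
  next
    case False
    then obtain w where w: "w \<in> Lsp X (Apairs X d g)" "w \<noteq> (\<lambda>x. 0)" by blast
    let ?w' = "\<lambda>x. - w x"
    have w': "?w' \<in> Lsp X (Apairs X d g)" "?w' \<noteq> (\<lambda>x. 0)"
    proof -
      have "- w x + - w y = 0" if "{x, y} \<in> Apairs X d g" for x y
      proof -
        have "w x + w y = 0" using w(1) that by (simp add: Lsp_def)
        then show ?thesis by linarith
      qed
      then show "?w' \<in> Lsp X (Apairs X d g)" using w(1) by (simp add: Lsp_def RX_def)
      show "?w' \<noteq> (\<lambda>x. 0)" using w(2) by (auto simp: fun_eq_iff)
    qed
    obtain s where s: "s > 0" "(\<lambda>x. g x + s * w x) \<in> convex_hull_fun (vertices A)"
      using endpoint[OF gE w] IH by blast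
    obtain s' where s': "s' > 0" "(\<lambda>x. g x + s' * - w x) \<in> convex_hull_fun (vertices A)"
      using endpoint[OF gE w'] IH by blast
    \<comment> \<open>With this weight the multiples of \<open>w\<close> cancel:
      \<open>(1 - t) * s = t * s'\<close>.\<close>
    define t where "t = s / (s + s')"
    have t: "0 \<le> t" "t \<le> 1" using s(1) s'(1) by (auto simp: t_def)
    have ts: "t * (s + s') = s" using s(1) s'(1) by (simp add: t_def)
    have "(1 - t) * (g x + s * w x) + t * (g x + s' * - w x) = g x" for x
    proof -
      have "(1 - t) * (g x + s * w x) + t * (g x + s' * - w x) = g x + (s - t * (s + s')) * w x"
        by (simp add: algebra_simps)
      then show ?thesis unfolding ts by simp
    qed
    then show ?thesis using convex_hull_fun_convex[OF s(2) s'(2) t] by simp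
  qed
qed

lemma Pcell_nonempty: "A \<in> Afam X d \<Longrightarrow> Pcell X d A \<noteq> {}"
  using self_in_Pcell by (auto simp: Afam_def)

lemma vertices_nonempty:
  assumes "A \<in> Afam X d"
  shows "vertices A \<noteq> {}"
proof
  assume "vertices A = {}"
  then have "convex_hull_fun (vertices A) = {}" by (simp add: convex_hull_fun_def)
  then show False using Pcell_subset_hull[OF assms] Pcell_nonempty[OF assms] by blast
qed

lemma polytope_Pcell:
  assumes A: "A \<in> Afam X d"
  shows "polytope_fun (Pcell X d A)"
proof -
  have "convex_hull_fun (vertices A) \<subseteq> Pcell X d A"
  proof
    fix g assume "g \<in> convex_hull_fun (vertices A)"
    then obtain c where c: "g = (\<lambda>x. \<Sum>v\<in>vertices A. c v * v x)" "\<forall>v\<in>vertices A. c v \<ge> 0"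
      "(\<Sum>v\<in>vertices A. c v) = 1" by (auto simp: convex_hull_fun_def)
    have vC: "v \<in> Pcell X d A" if "v \<in> vertices A" for v using that by (simp add: vertices_def)
    have vD: "v \<in> Delta X d" if "v \<in> vertices A" for v using vC[OF that] by (simp add: Pcell_iff[OF A])
    have g_sum: "g x + g y = (\<Sum>v\<in>vertices A. c v * (v x + v y))" for x y
      by (simp add: c(1) distrib_left sum.distrib)
    \<comment> \<open>Writing the constant as the same weighted sum allows the constraints to be
      compared vertex by vertex.\<close>
    have d_sum: "d x y = (\<Sum>v\<in>vertices A. c v * d x y)" for x y
      using c(3) by (simp flip: sum_distrib_right)
    have "d x y \<le> g x + g y" if "x \<in> X" "y \<in> X" for x y
      unfolding g_sum by (subst d_sum) (use c(2) DeltaD[OF vD that] in \<open>intro sum_mono mult_left_mono, auto\<close>)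
    moreover have "g x = 0" if x: "x \<notin> X" for x
      unfolding c(1) by (rule sum.neutral) (use Delta_outside[OF vD x] in simp)
    ultimately have gD: "g \<in> Delta X d" by (simp add: Delta_def RX_def)
    have "e \<in> Apairs X d g" if e: "e \<in> A" for e
    proof -
      obtain x y where xy: "e = {x, y}" "x \<in> X" "y \<in> X" using e A by (auto simp: Afam_def Apairs_def)
      have "v x + v y = d x y" if "v \<in> vertices A" for v
        using vC[OF that] e by (auto simp: Pcell_iff[OF A] xy(1) pair_in_Apairs[symmetric])
          (metis pair_in_Apairs subsetD)
      then have "g x + g y = (\<Sum>v\<in>vertices A. c v * d x y)" unfolding g_sum by simp
      then show ?thesis using d_sum[of x y] xy by (simp add: pair_in_Apairs)
    qed
    then show "g \<in> Pcell X d A" using gD by (auto simp: Pcell_iff[OF A])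
  qed
  then have "Pcell X d A = convex_hull_fun (vertices A)" using Pcell_subset_hull[OF A] by blast
  then show ?thesis unfolding polytope_fun_def
    using finite_vertices[OF A] vertices_nonempty[OF A] by blast
qed

section \<open>Isometry types of cells\<close>

text \<open>An independent family in \<open>Lsp\<close>, scaled by one small factor, consists of
  differences of points of the cell, since \<open>f\<close> is relatively interior.\<close>

lemma dim_le_if_adim_le:
  assumes f: "f \<in> Eprime X d" and dim: "adim (Pcell X d (Apairs X d f)) \<le> enat n"
  shows "Lsp_dim_le X (Apairs X d f) n"
  unfolding Lsp_dim_le_def
proof (intro allI impI)
  let ?C = "Pcell X d (Apairs X d f)"
  fix V assume V: "lin_indep V" "V \<subseteq> Lsp X (Apairs X d f)"
  have finV: "finite V" using V by (simp add: lin_indep_def)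
  have "\<forall>v\<in>V. \<exists>\<epsilon>>0. \<forall>s. \<bar>s\<bar> \<le> \<epsilon> \<longrightarrow> (\<lambda>x. f x + s * v x) \<in> ?C" using interior[OF f] V by blast
  then obtain \<epsilon> where \<epsilon>: "\<And>v. v \<in> V \<Longrightarrow> \<epsilon> v > 0"
    "\<And>v s. v \<in> V \<Longrightarrow> \<bar>s\<bar> \<le> \<epsilon> v \<Longrightarrow> (\<lambda>x. f x + s * v x) \<in> ?C" by metis
  define e where "e = Min (insert 1 (\<epsilon> ` V))"
  have e: "e > 0" "\<And>v. v \<in> V \<Longrightarrow> e \<le> \<epsilon> v" unfolding e_def using finV \<epsilon>(1) by auto
  have sub: "(\<lambda>v x. e * v x) ` V \<subseteq> {(\<lambda>x. q x - f x) | q. q \<in> ?C}"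
  proof
    fix u assume "u \<in> (\<lambda>v x. e * v x) ` V"
    then obtain v where v: "v \<in> V" "u = (\<lambda>x. e * v x)" by blast
    have "(\<lambda>x. f x + e * v x) \<in> ?C" using e v(1) by (intro \<epsilon>(2)) auto
    then show "u \<in> {(\<lambda>x. q x - f x) | q. q \<in> ?C}"
      by (intro CollectI exI[of _ "\<lambda>x. f x + e * v x"]) (simp add: v(2))
  qed
  have "card ((\<lambda>v x. e * v x) ` V) \<le> n"
    using dim[unfolded adim_le_iff, rule_format, OF self_in_Pcell[OF f] _ sub] lin_indep_scale(1)[OF V(1)] e(1) by auto
  then show "card V \<le> n" using lin_indep_scale(2)[OF V(1)] e(1) by simp
qed

definition has_types :: "'a set set \<Rightarrow> ('a \<Rightarrow> nat) \<Rightarrow> bool" where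
  "has_types A \<tau> \<longleftrightarrow> (\<forall>w\<in>Lsp X A. \<forall>x\<in>X. \<forall>y\<in>X. \<tau> x = \<tau> y \<longrightarrow> w x = w y)"

text \<open>In the coordinates given by a type function and a half-integral base point \<open>v\<close>, a cell is cut
  out by finitely many constraints: equations, indexed by \<open>tight_types\<close>, and
  inequalities with half-integral constants, listed by \<open>slack_types\<close>
  up to the bound \<open>J / 2\<close>, beyond which they are implied by the bound on the diameter.\<close>
definition tight_types :: "'a set set \<Rightarrow> ('a \<Rightarrow> nat) \<Rightarrow> (nat \<times> nat) set" where
  "tight_types A \<tau> = {(\<tau> x, \<tau> y) | x y. {x, y} \<in> A}"

definition slack_types :: "('a \<Rightarrow> real) \<Rightarrow> ('a \<Rightarrow> nat) \<Rightarrow> nat \<Rightarrow> (nat \<times> nat \<times> nat) set" where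
  "slack_types v \<tau> J = {(\<tau> x, \<tau> y, j) | x y j.
     x \<in> X \<and> y \<in> X \<and> j \<le> J \<and> real j = 2 * (v x + v y - d x y)}"

text \<open>The displacement \<open>u - v\<close> is constant on types and is added to
  \<open>v'\<close> along matching types. Equations transfer by \<open>tight_types\<close>,
  inequalities with small slack by \<open>slack_types\<close>.\<close>

lemma transfer_cell:
  assumes A: "A \<in> Afam X d" and A': "A' \<in> Afam X d"
    and v: "v \<in> Pcell X d A" and v': "v' \<in> Pcell X d A'"
    and ty: "has_types A \<tau>" and ty': "has_types A' \<tau>'"
    and half: "\<forall>x\<in>X. 2 * v' x \<in> \<int>"
    and D: "\<forall>u\<in>Pcell X d A. \<forall>x\<in>X. \<bar>u x - v x\<bar> \<le> D" and J: "4 * D \<le> real J"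
    and eqS: "tight_types A \<tau> = tight_types A' \<tau>'" and eqQ: "slack_types v \<tau> J = slack_types v' \<tau>' J"
    and img: "\<tau> ` X = \<tau>' ` X"
  shows "\<exists>\<phi>. \<forall>u\<in>Pcell X d A. \<phi> u \<in> Pcell X d A' \<and>
    (\<forall>x\<in>X. \<forall>y\<in>X. \<tau> x = \<tau>' y \<longrightarrow> \<phi> u y - v' y = u x - v x)"
proof -
  define sel where "sel y = (SOME x. x \<in> X \<and> \<tau> x = \<tau>' y)" for y
  have sel: "sel y \<in> X \<and> \<tau> (sel y) = \<tau>' y" if "y \<in> X" for y
    unfolding sel_def by (rule someI_ex) (use that img in \<open>metis imageE imageI\<close>)
  define \<phi> where "\<phi> u y = (if y \<in> X then v' y + (u (sel y) - v (sel y)) else 0)" for u y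
  have match: "\<phi> u y - v' y = u x - v x" if u: "u \<in> Pcell X d A" and xy: "x \<in> X" "y \<in> X" "\<tau> x = \<tau>' y" for u x y
    using ty[unfolded has_types_def, rule_format, OF Pcell_diff_in_Lsp[OF v u], of "sel y" x] sel xy
    by (auto simp: \<phi>_def)
  have "\<phi> u \<in> Pcell X d A'" if u: "u \<in> Pcell X d A" for u
  proof -
    have uD: "u \<in> Delta X d" and vD': "v' \<in> Delta X d"
      using u v' by (auto simp: Pcell_iff[OF A] Pcell_iff[OF A'])
    have "d x' y' \<le> \<phi> u x' + \<phi> u y'" if xy': "x' \<in> X" "y' \<in> X" for x' y'
    proof -
      define r where "r = 2 * (v' x' + v' y' - d x' y')"
      have "r = 2 * v' x' + 2 * v' y' - 2 * d x' y'" by (simp add: r_def)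
      also have "\<dots> \<in> \<int>" using half xy' d_Ints by simp
      finally have "r \<in> \<int>" .
      moreover have "r \<ge> 0" using DeltaD[OF vD' xy'] by (simp add: r_def)
      ultimately have "r \<in> \<nat>" by (simp add: Nats_altdef2)
      then obtain j where j: "r = real j" by (auto elim: Nats_cases)
      show ?thesis
      proof (cases "j \<le> J")
        case True
        then have "(\<tau>' x', \<tau>' y', j) \<in> slack_types v' \<tau>' J"
          unfolding slack_types_def using xy' j r_def by blast
        then have "(\<tau>' x', \<tau>' y', j) \<in> slack_types v \<tau> J" by (simp add: eqQ)
        then obtain x y where xy: "\<tau> x = \<tau>' x'" "\<tau> y = \<tau>' y'" "x \<in> X" "y \<in> X"
          "real j = 2 * (v x + v y - d x y)" by (auto simp: slack_types_def)
        have "v x + v y - d x y = v' x' + v' y' - d x' y'" using xy(5) j r_def by simp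
        then show ?thesis
          using match[OF u xy(3) xy'(1) xy(1)] match[OF u xy(4) xy'(2) xy(2)] DeltaD[OF uD xy(3,4)]
          by linarith
      next
        case False
        \<comment> \<open>Here the slack at \<open>v'\<close> is at least \<open>2 * D\<close>,
          while each of the two points is displaced by at most \<open>D\<close>.\<close>
        then have "4 * D \<le> r" using J j by simp
        moreover have "\<bar>u (sel x') - v (sel x')\<bar> \<le> D" "\<bar>u (sel y') - v (sel y')\<bar> \<le> D"
          using D u sel xy' by blast+
        ultimately show ?thesis using xy' by (simp add: \<phi>_def r_def)
      qed
    qed
    then have "\<phi> u \<in> Delta X d" by (simp add: Delta_def RX_def \<phi>_def)
    moreover have "e \<in> Apairs X d (\<phi> u)" if e: "e \<in> A'" for e
    proof -
      obtain x' y' where xy': "e = {x', y'}" "x' \<in> X" "y' \<in> X" using e A' by (auto simp: Afam_def Apairs_def)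
      have v'e: "v' x' + v' y' = d x' y'"
        using v' e Pcell_iff[OF A'] pair_in_Apairs unfolding xy' by blast
      have "(\<tau>' x', \<tau>' y') \<in> tight_types A' \<tau>'" unfolding tight_types_def using e xy' by blast
      then have "(\<tau>' x', \<tau>' y') \<in> tight_types A \<tau>" by (simp add: eqS)
      then obtain x y where xy: "\<tau> x = \<tau>' x'" "\<tau> y = \<tau>' y'" "{x, y} \<in> A" by (auto simp: tight_types_def)
      have "{x, y} \<in> Apairs X d u" "{x, y} \<in> Apairs X d v" using u v xy(3) Pcell_iff[OF A] by blast+
      then have "x \<in> X" "y \<in> X" "u x + u y = d x y" "v x + v y = d x y" by (auto simp: pair_in_Apairs)
      then have "\<phi> u x' + \<phi> u y' = d x' y'"
        using match[OF u _ xy'(2) xy(1)] match[OF u _ xy'(3) xy(2)] v'e by linarith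
      then show ?thesis using xy' by (simp add: pair_in_Apairs)
    qed
    ultimately show ?thesis by (auto simp: Pcell_iff[OF A'])
  qed
  then show ?thesis using match by blast
qed

definition cell_code :: "nat \<Rightarrow> nat \<Rightarrow> real \<Rightarrow> ('a \<Rightarrow> real) set \<Rightarrow> (nat \<times> nat) set \<times> (nat \<times> nat \<times> nat) set \<Rightarrow> bool" where
  "cell_code M J D C c \<longleftrightarrow> (\<exists>A v \<tau>. A \<in> Afam X d \<and> C = Pcell X d A \<and> v \<in> C \<and> has_types A \<tau> \<and>
     \<tau> ` X \<subseteq> {..<M} \<and> (\<forall>x\<in>X. 2 * v x \<in> \<int>) \<and> (\<forall>u\<in>C. \<forall>x\<in>X. \<bar>u x - v x\<bar> \<le> D) \<and>
     c = (tight_types A \<tau>, slack_types v \<tau> J))"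

text \<open>Every point lies in a tight pair; hence equal codes involve the same types.\<close>

lemma types_image:
  assumes "A \<in> Afam X d"
  shows "\<tau> ` X = fst ` tight_types A \<tau>"
proof -
  obtain f where f: "f \<in> Eprime X d" "A = Apairs X d f" using assms by (auto simp: Afam_def)
  have "\<exists>y. {x, y} \<in> A" if "x \<in> X" for x
    using Eprime_partner[OF f(1) that] that by (metis f(2) pair_in_Apairs)
  moreover have "x \<in> X" if "{x, y} \<in> A" for x y using that by (simp add: f(2) pair_in_Apairs)
  ultimately show ?thesis unfolding tight_types_def by force
qed

text \<open>The transfers in both directions are mutually inverse. They preserve the set of values
  of differences, hence the supremum distance.\<close>

lemma isometric_if_same_code:
  assumes c: "cell_code M J D C c" and c': "cell_code M J D C' c" and J: "4 * D \<le> real J"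
  shows "isometric_cells X C C'"
proof -
  obtain A v \<tau> where A: "A \<in> Afam X d" "C = Pcell X d A" "v \<in> Pcell X d A" "has_types A \<tau>"
    "\<forall>x\<in>X. 2 * v x \<in> \<int>" "\<forall>u\<in>Pcell X d A. \<forall>x\<in>X. \<bar>u x - v x\<bar> \<le> D"
    "c = (tight_types A \<tau>, slack_types v \<tau> J)" using c unfolding cell_code_def by blast
  obtain A' v' \<tau>' where A': "A' \<in> Afam X d" "C' = Pcell X d A'" "v' \<in> Pcell X d A'" "has_types A' \<tau>'"
    "\<forall>x\<in>X. 2 * v' x \<in> \<int>" "\<forall>u\<in>Pcell X d A'. \<forall>x\<in>X. \<bar>u x - v' x\<bar> \<le> D"
    "c = (tight_types A' \<tau>', slack_types v' \<tau>' J)" using c' unfolding cell_code_def by blast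
  have eq: "tight_types A \<tau> = tight_types A' \<tau>'" "slack_types v \<tau> J = slack_types v' \<tau>' J"
    using A(7) A'(7) by simp_all
  have img: "\<tau> ` X = \<tau>' ` X" using types_image[OF A(1)] types_image[OF A'(1)] eq(1) by simp
  obtain \<phi> where \<phi>: "\<And>u. u \<in> C \<Longrightarrow> \<phi> u \<in> C'"
    "\<And>u x y. u \<in> C \<Longrightarrow> x \<in> X \<Longrightarrow> y \<in> X \<Longrightarrow> \<tau> x = \<tau>' y \<Longrightarrow> \<phi> u y - v' y = u x - v x"
    using transfer_cell[OF A(1) A'(1) A(3) A'(3) A(4) A'(4) A'(5) A(6) J eq img]
    unfolding A(2) A'(2) by metis
  obtain \<psi> where \<psi>: "\<And>u. u \<in> C' \<Longrightarrow> \<psi> u \<in> C"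
    "\<And>u x y. u \<in> C' \<Longrightarrow> x \<in> X \<Longrightarrow> y \<in> X \<Longrightarrow> \<tau>' x = \<tau> y \<Longrightarrow> \<psi> u y - v y = u x - v' x"
    using transfer_cell[OF A'(1) A(1) A'(3) A(3) A'(4) A(4) A(5) A'(6) J eq[symmetric] img[symmetric]]
    unfolding A(2) A'(2) by metis
  have out: "u x = 0" if "u \<in> C \<or> u \<in> C'" "x \<notin> X" for u x
    using that Delta_outside Eprime_Delta Pcell_Eprime unfolding A(2) A'(2) by blast
  have "\<psi> (\<phi> u) = u" if u: "u \<in> C" for u
  proof
    fix x show "\<psi> (\<phi> u) x = u x"
    proof (cases "x \<in> X")
      case True
      obtain y where "y \<in> X" "\<tau> x = \<tau>' y" using True img by (metis imageE imageI)
      then show ?thesis using \<phi>(2)[OF u True] \<psi>(2)[OF \<phi>(1)[OF u] _ True] by force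
    next
      case False
      then show ?thesis using out u \<phi>(1) \<psi>(1) by metis
    qed
  qed
  moreover have "\<phi> (\<psi> u) = u" if u: "u \<in> C'" for u
  proof
    fix x show "\<phi> (\<psi> u) x = u x"
    proof (cases "x \<in> X")
      case True
      obtain y where "y \<in> X" "\<tau>' x = \<tau> y" using True img by (metis imageE imageI)
      then show ?thesis using \<psi>(2)[OF u True] \<phi>(2)[OF \<psi>(1)[OF u] _ True] by force
    next
      case False
      then show ?thesis using out u \<phi>(1) \<psi>(1) by metis
    qed
  qed
  ultimately have bij: "bij_betw \<phi> C C'"
    using \<phi>(1) \<psi>(1) by (intro bij_betw_byWitness[of C \<psi> \<phi> C']) auto
  have "supdist X (\<phi> u) (\<phi> u') = supdist X u u'" if u: "u \<in> C" and u': "u' \<in> C" for u u'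
  proof -
    have eqd: "\<bar>\<phi> u y - \<phi> u' y\<bar> = \<bar>u x - u' x\<bar>" if "x \<in> X" "y \<in> X" "\<tau> x = \<tau>' y" for x y
      using \<phi>(2)[OF u that] \<phi>(2)[OF u' that] by linarith
    have "(\<lambda>y. ereal \<bar>\<phi> u y - \<phi> u' y\<bar>) ` X = (\<lambda>x. ereal \<bar>u x - u' x\<bar>) ` X"
    proof (intro equalityI subsetI)
      fix r assume "r \<in> (\<lambda>y. ereal \<bar>\<phi> u y - \<phi> u' y\<bar>) ` X"
      then obtain y where y: "y \<in> X" "r = ereal \<bar>\<phi> u y - \<phi> u' y\<bar>" by blast
      obtain x where "x \<in> X" "\<tau> x = \<tau>' y" using y(1) img by (metis imageE imageI)
      then show "r \<in> (\<lambda>x. ereal \<bar>u x - u' x\<bar>) ` X" using eqd y by auto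
    next
      fix r assume "r \<in> (\<lambda>x. ereal \<bar>u x - u' x\<bar>) ` X"
      then obtain x where x: "x \<in> X" "r = ereal \<bar>u x - u' x\<bar>" by blast
      obtain y where "y \<in> X" "\<tau> x = \<tau>' y" using x(1) img by (metis imageE imageI)
      then show "r \<in> (\<lambda>y. ereal \<bar>\<phi> u y - \<phi> u' y\<bar>) ` X" using eqd[of x y] x by force
    qed
    then show ?thesis by (simp add: supdist_def)
  qed
  then show ?thesis unfolding isometric_cells_def using bij by blast
qed

lemma finitely_many_cells_of_bounded_diam:
  assumes sub: "\<C> \<subseteq> n_cells (Pcell X d ` Afam X d) n" and diam: "\<And>C. C \<in> \<C> \<Longrightarrow> diam_le X C D"
  shows "finitely_many_isometry_types X \<C>"
proof -
  define M where "M = (2 * n + 1) ^ n"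
  \<comment> \<open>Slacks are counted in halves, and those up to \<open>2 * D\<close> must be
    recorded.\<close>
  define J where "J = nat \<lceil>4 * D\<rceil>"
  have J: "4 * D \<le> real J" unfolding J_def by (rule real_nat_ceiling_ge)
  let ?K = "Pow ({..<M} \<times> {..<M}) \<times> Pow ({..<M} \<times> {..<M} \<times> {..J})"
  show ?thesis
  proof (rule finitely_many_isometry_types_by_codes)
    show "finite ?K" by simp
    show "isometric_cells X C C'" if "cell_code M J D C c" "cell_code M J D C' c" for C C' c
      using isometric_if_same_code[OF that J] .
    fix C assume C: "C \<in> \<C>"
    then obtain f where f: "f \<in> Eprime X d" "C = Pcell X d (Apairs X d f)" "adim C = enat n"
      using sub by (auto simp: n_cells_def Afam_def)
    define A where "A = Apairs X d f"
    have A: "A \<in> Afam X d" using f(1) by (simp add: A_def Apairs_in_Afam)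
    have dim: "Lsp_dim_le X A n" unfolding A_def using dim_le_if_adim_le[OF f(1)] f by simp
    obtain \<tau> :: "'a \<Rightarrow> nat" where \<tau>: "\<tau> ` X \<subseteq> {..<M}" "has_types A \<tau>"
      using Lsp_types[OF dim] Union_Apairs_subset[of f] unfolding has_types_def M_def A_def by blast
    \<comment> \<open>A vertex is the half-integral base point required for the code.\<close>
    obtain v where v: "v \<in> vertices A" using vertices_nonempty[OF A] by blast
    then have half: "2 * v x \<in> \<int>" if "x \<in> X" for x
      using half_integral_if_Lsp_trivial[OF Pcell_Eprime] that by (auto simp: vertices_def f(2) A_def)
    have vC: "v \<in> C" using v by (simp add: vertices_def f(2) A_def)
    have bd: "\<bar>u x - v x\<bar> \<le> D" if "u \<in> C" "x \<in> X" for u x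
      using diam[OF C] vC that by (auto simp: diam_le_def supdist_le_iff)
    have code: "cell_code M J D C (tight_types A \<tau>, slack_types v \<tau> J)"
      unfolding cell_code_def
      by (rule exI[of _ A], rule exI[of _ v], rule exI[of _ \<tau>]) (use A f vC \<tau> half bd in \<open>auto simp: A_def\<close>)
    have "tight_types A \<tau> \<subseteq> {..<M} \<times> {..<M}"
      using \<tau>(1) by (auto simp: tight_types_def A_def pair_in_Apairs)
    moreover have "slack_types v \<tau> J \<subseteq> {..<M} \<times> {..<M} \<times> {..J}"
      using \<tau>(1) by (auto simp: slack_types_def)
    ultimately show "\<exists>c\<in>?K. cell_code M J D C c" using code by blast
  qed
qed

text \<open>The difference of two elements of a cell is 2-Lipschitz, takes few values,
  and takes with each value also its negative.\<close>
lemma diam_le_if_discretely_path_connected: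
  assumes conn: "discretely_path_connected X d" and C: "C \<in> n_cells (Pcell X d ` Afam X d) n"
  shows "diam_le X C (2 * real n + 2)"
proof -
  obtain f where f: "f \<in> Eprime X d" "C = Pcell X d (Apairs X d f)" "adim C = enat n"
    using C by (auto simp: n_cells_def Afam_def)
  have dim: "Lsp_dim_le X (Apairs X d f) n" using dim_le_if_adim_le[OF f(1)] f by simp
  have le: "u x - v x \<le> 2 * real n + 2" if u: "u \<in> C" and v: "v \<in> C" and x: "x \<in> X" for u v x
  proof (rule ccontr)
    assume neg: "\<not> ?thesis"
    define w where "w x = u x - v x" for x
    have wL: "w \<in> Lsp X (Apairs X d f)"
      unfolding w_def using u v f(2) by (intro Pcell_diff_in_Lsp) auto
    have card: "finite (w ` X)" "card (w ` X) \<le> 2 * n + 1"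
      using Lsp_finite_range[OF dim Union_Apairs_subset wL] by auto
    obtain y where y: "y \<in> X" "f x + f y = d x y" using Eprime_partner[OF f(1) x] .
    then have wy: "w y = - w x" using wL x by (simp add: Lsp_def pair_in_Apairs add.commute eq_neg_iff_add_eq_0)
    obtain \<gamma> :: "nat \<Rightarrow> 'a" and l where \<gamma>: "\<gamma> 0 = y" "\<gamma> l = x" "\<And>k. k \<le> l \<Longrightarrow> \<gamma> k \<in> X"
      "\<And>k. k \<in> {1..l} \<Longrightarrow> d (\<gamma> (k - 1)) (\<gamma> k) = 1"
      using conn x y(1) unfolding discretely_path_connected_def by metis
    have uvE: "u \<in> Eprime X d" "v \<in> Eprime X d" using u v f(2) Pcell_Eprime by auto
    \<comment> \<open>From \<open>y\<close> to \<open>x\<close> the value of \<open>w\<close> rises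
      by \<open>2 * w x\<close>, more than \<open>2 * (2 * n + 2)\<close>, in steps of at most 2.
      This yields one value more than the rank permits.\<close>
    have "2 * n + 2 \<le> card (w ` X)"
    proof (rule card_values_of_walk[where w = "\<lambda>k. w (\<gamma> k)" and l = l])
      show "w (\<gamma> k) \<in> w ` X" if "k \<le> l" for k using \<gamma>(3)[OF that] by simp
      show "w (\<gamma> (Suc k)) \<le> w (\<gamma> k) + 2" if "k < l" for k
      proof -
        have X: "\<gamma> k \<in> X" "\<gamma> (Suc k) \<in> X" using \<gamma>(3) that by auto
        have "d (\<gamma> k) (\<gamma> (Suc k)) = 1" using \<gamma>(4)[of "Suc k"] that by simp
        then show ?thesis
          using Eprime_lipschitz[OF uvE(1) X(2,1)] Eprime_lipschitz[OF uvE(2) X] d_sym[OF X]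
          unfolding w_def by linarith
      qed
      show "w (\<gamma> 0) + 2 * real (2 * n + 2) \<le> w (\<gamma> l)"
        using neg wy unfolding \<gamma>(1,2) by (simp add: w_def)
    qed (rule card(1))
    then show False using card(2) by simp
  qed
  have "\<bar>u x - v x\<bar> \<le> 2 * real n + 2" if "u \<in> C" "v \<in> C" "x \<in> X" for u v x
    using le[OF that] le[OF that(2,1,3)] by linarith
  then show ?thesis by (simp add: diam_le_def supdist_le_iff)
qed

section \<open>The polyhedral structure and its local dimension\<close>

lemma polyhedral_structure_cells:
  "polyhedral_structure (Pcell X d ` Afam X d) (Eprime X d)"
  unfolding polyhedral_structure_def
proof (intro conjI ballI allI impI)
  show "\<Union>(Pcell X d ` Afam X d) = Eprime X d"
    using self_in_Pcell Apairs_in_Afam Pcell_Eprime by blast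
  fix C assume "C \<in> Pcell X d ` Afam X d"
  then obtain A where A: "A \<in> Afam X d" "C = Pcell X d A" by blast
  show "polytope_fun C" using polytope_Pcell A by simp
  show "F \<in> Pcell X d ` Afam X d" if "face_fun F C" for F using face_in_cells A that by simp
  fix C' assume "C' \<in> Pcell X d ` Afam X d"
  then obtain A' where A': "A' \<in> Afam X d" "C' = Pcell X d A'" by blast
  show "C \<inter> C' = {} \<or> face_fun (C \<inter> C') C \<and> face_fun (C \<inter> C') C'"
    using Pcell_Int_face[OF A(1) A'(1)] Pcell_Int_face[OF A'(1) A(1)] unfolding A(2) A'(2)
    by (metis Int_commute)
qed

text \<open>The rank bound concerns points near \<open>f\<close>; a cell that meets the neighbourhood contains such
  points with the minimal tight set of the cell, on a segment towards its relative interior.\<close>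
lemma adim_le_near:
  assumes C: "C \<in> Pcell X d ` Afam X d" and g: "g \<in> C" and near: "supdist X f g < ereal \<epsilon>"
    and rk: "\<And>g. g \<in> Eprime X d \<Longrightarrow> supdist X f g < ereal \<epsilon> \<Longrightarrow> rk X d (Apairs X d g) \<le> enat N"
  shows "adim C \<le> enat N"
proof -
  obtain h where h: "h \<in> Eprime X d" "C = Pcell X d (Apairs X d h)" using C by (auto simp: Afam_def)
  have gE: "g \<in> Eprime X d" using g h Pcell_Eprime by blast
  obtain B where B: "B \<ge> 0" "\<And>x. x \<in> X \<Longrightarrow> \<bar>h x - g x\<bar> \<le> B" using Eprime_diff_bounded[OF h(1) gE] by blast
  obtain \<epsilon>' where \<epsilon>': "\<epsilon>' < \<epsilon>" "\<And>x. x \<in> X \<Longrightarrow> \<bar>f x - g x\<bar> \<le> \<epsilon>'" using supdist_less_imp_bound[OF near] by blast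
  \<comment> \<open>The displacement \<open>s * B\<close> uses at most half of the room up to
    \<open>\<epsilon>\<close>; \<open>B + 1\<close> avoids division by 0.\<close>
  define s where "s = min (1 / 2) ((\<epsilon> - \<epsilon>') / (2 * (B + 1)))"
  have s: "0 < s" "s < 1" "s * B \<le> (\<epsilon> - \<epsilon>') / 2"
  proof -
    show "0 < s" "s < 1" using \<epsilon>'(1) B(1) by (auto simp: s_def)
    have "s * B \<le> s * (B + 1)" using \<open>0 < s\<close> by simp
    also have "\<dots> \<le> (\<epsilon> - \<epsilon>') / (2 * (B + 1)) * (B + 1)" using B(1) by (intro mult_right_mono) (auto simp: s_def)
    also have "\<dots> = (\<epsilon> - \<epsilon>') / 2" using B(1) nonzero_mult_divide_mult_cancel_right[of "B + 1" "\<epsilon> - \<epsilon>'" 2] by (simp only: times_divide_eq_left)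
    finally show "s * B \<le> (\<epsilon> - \<epsilon>') / 2" .
  qed
  define p where "p = (\<lambda>x. (1 - s) * g x + s * h x)"
  have pA: "Apairs X d p = Apairs X d h"
  proof -
    have "Apairs X d h \<subseteq> Apairs X d g" using g by (simp add: h(2) Pcell_iff[OF Apairs_in_Afam[OF h(1)]])
    then show ?thesis
      unfolding p_def using Apairs_convex[OF Eprime_Delta[OF gE] Eprime_Delta[OF h(1)] s(1,2)] by auto
  qed
  have "p \<in> Delta X d" unfolding p_def using s by (intro Delta_convex Eprime_Delta gE h(1)) auto
  then have pE: "p \<in> Eprime X d" using Eprime_if_Apairs_subset[OF h(1)] pA by blast
  have "\<bar>f x - p x\<bar> \<le> (\<epsilon> + \<epsilon>') / 2" if x: "x \<in> X" for x
  proof -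
    have eq: "f x - p x = (f x - g x) - s * (h x - g x)" by (simp add: p_def algebra_simps)
    have "\<bar>s * (h x - g x)\<bar> \<le> s * B" unfolding abs_mult using s(1) B(2)[OF x] by simp
    then have "\<bar>f x - p x\<bar> \<le> \<epsilon>' + (\<epsilon> - \<epsilon>') / 2"
      unfolding eq using abs_triangle_ineq4[of "f x - g x" "s * (h x - g x)"] \<epsilon>'(2)[OF x] s(3) by linarith
    then show ?thesis by argo
  qed
  then have "supdist X f p \<le> ereal ((\<epsilon> + \<epsilon>') / 2)" by (simp add: supdist_le_iff)
  also have "\<dots> < ereal \<epsilon>" using \<epsilon>'(1) by simp
  finally have "rk X d (Apairs X d h) \<le> enat N" using rk[OF pE] pA by simp
  moreover have "adim C \<le> rk X d (Apairs X d h)"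
    unfolding rk_def h(2) by (rule adim_mono) (auto simp: Pcell_def)
  ultimately show ?thesis by (rule order_trans[rotated])
qed

end

section \<open>Deduction of the assertions from the local rank bound\<close>

theorem theorem4p5:
  fixes X :: "'a set" and d :: "'a \<Rightarrow> 'a \<Rightarrow> real"
  assumes metric: "metric_on X d"
    and intval: "int_valued X d"
    and rkbound: "\<forall>f\<in>Ehull X d. \<exists>\<epsilon>>0. \<exists>N::nat. N > 0 \<and>
                    (\<forall>g\<in>Eprime X d. supdist X f g < ereal \<epsilon> \<longrightarrow>
                       rk X d (Apairs X d g) \<le> enat N)"
  shows "Eprime X d = Ehull X d
    \<and> (polyhedral_structure (Pcell X d ` Afam X d) (Ehull X d)
         \<and> locally_finite_dim X (Pcell X d ` Afam X d) (Ehull X d)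
         \<and> (\<forall>A\<in>Afam X d. \<forall>A'\<in>Afam X d.
               face_fun (Pcell X d A') (Pcell X d A) \<longleftrightarrow> A \<subseteq> A'))
    \<and> (\<forall>n\<ge>1. \<forall>D>0. finitely_many_isometry_types X
            {C \<in> n_cells (Pcell X d ` Afam X d) n. diam_le X C D})
    \<and> (discretely_path_connected X d \<longrightarrow>
           (\<forall>n. finitely_many_isometry_types X (n_cells (Pcell X d ` Afam X d) n)))"
proof -
  interpret int_metric X d using metric intval by unfold_locales
  have rk_dim: "Lsp_dim_le X (Apairs X d g) N"
    if "g \<in> Eprime X d" "rk X d (Apairs X d g) \<le> enat N" for g N
    using that rk_le_iff[of g X d "Apairs X d g" N] self_in_Pcell[of g] by (simp add: Pcell_def)
  have near: "supdist X f g < ereal \<epsilon>" if "\<And>x. x \<in> X \<Longrightarrow> \<bar>f x - g x\<bar> \<le> \<epsilon> / 2" "\<epsilon> > 0" for f g \<epsilon>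
  proof -
    have "supdist X f g \<le> ereal (\<epsilon> / 2)" using that by (simp add: supdist_le_iff)
    also have "\<dots> < ereal \<epsilon>" using that by simp
    finally show ?thesis .
  qed
  interpret int_metric_locally_finite_rank X d
  proof unfold_locales
    fix f assume f: "f \<in> Eprime X d"
    then obtain \<epsilon> N where "\<epsilon> > 0" "\<forall>g\<in>Eprime X d. supdist X f g < ereal \<epsilon> \<longrightarrow> rk X d (Apairs X d g) \<le> enat N"
      using rkbound Eprime_subset_Ehull by blast
    moreover have "supdist X f f < ereal \<epsilon>" using \<open>\<epsilon> > 0\<close> by (intro near) auto
    ultimately show "\<exists>N. Lsp_dim_le X (Apairs X d f) N" using f rk_dim by blast
  qed
  have eq: "Eprime X d = Ehull X d"
  proof
    show "Ehull X d \<subseteq> Eprime X d"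
    proof
      fix f assume f: "f \<in> Ehull X d"
      then obtain \<epsilon> N where \<epsilon>: "\<epsilon> > 0"
        "\<And>g. g \<in> Eprime X d \<Longrightarrow> supdist X f g < ereal \<epsilon> \<Longrightarrow> rk X d (Apairs X d g) \<le> enat N"
        using rkbound by blast
      have "finite (frac ` f ` X)"
      proof (rule finite_frac_of_uniform_limit)
        \<comment> \<open>Approximants are also taken within \<open>\<epsilon> / 2\<close> of
          \<open>f\<close>, where the rank is at most \<open>N\<close>; so one count of residues
          serves for all \<open>e\<close>.\<close>
        fix e :: real assume "e > 0"
        then obtain g where g: "g \<in> Eprime X d" "\<forall>x\<in>X. \<bar>f x - g x\<bar> \<le> min e (\<epsilon> / 2)"
          using Eprime_dense[OF f, of "min e (\<epsilon> / 2)"] \<epsilon>(1) by auto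
        have "supdist X f g < ereal \<epsilon>" using g(2) \<epsilon>(1) by (intro near) auto
        then have "finite (frac ` g ` X) \<and> card (frac ` g ` X) \<le> 2 * N + 2"
          using finite_frac[OF g(1) rk_dim[OF g(1) \<epsilon>(2)[OF g(1)]]] by simp
        then show "\<exists>g. (\<forall>x\<in>X. \<bar>f x - g x\<bar> \<le> e) \<and> finite (frac ` g ` X) \<and> card (frac ` g ` X) \<le> 2 * N + 2"
          using g(2) by auto
      qed
      then show "f \<in> Eprime X d" by (rule Ehull_Eprime_if_finite_frac[OF f])
    qed
  qed (rule Eprime_subset_Ehull)
  have "locally_finite_dim X (Pcell X d ` Afam X d) (Ehull X d)"
    unfolding locally_finite_dim_def
  proof
    fix f assume "f \<in> Ehull X d"
    then obtain \<epsilon> N where \<epsilon>: "\<epsilon> > 0"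
      "\<And>g. g \<in> Eprime X d \<Longrightarrow> supdist X f g < ereal \<epsilon> \<Longrightarrow> rk X d (Apairs X d g) \<le> enat N"
      using rkbound by blast
    then show "\<exists>\<epsilon>>0. \<exists>N::nat. \<forall>C\<in>Pcell X d ` Afam X d.
        (\<exists>g\<in>C. supdist X f g < ereal \<epsilon>) \<longrightarrow> adim C \<le> enat N"
      using adim_le_near by blast
  qed
  moreover have "finitely_many_isometry_types X {C \<in> n_cells (Pcell X d ` Afam X d) n. diam_le X C D}" for n D
    by (rule finitely_many_cells_of_bounded_diam[where n = n and D = D]) auto
  moreover have "finitely_many_isometry_types X (n_cells (Pcell X d ` Afam X d) n)"
    if "discretely_path_connected X d" for n
    \<comment> \<open>The diameter bound depends on \<open>n\<close> only, so the bounded case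
      covers all \<open>n\<close>-cells.\<close>
    using diam_le_if_discretely_path_connected[OF that]
    by (intro finitely_many_cells_of_bounded_diam[where n = n]) auto
  ultimately show ?thesis
    using eq polyhedral_structure_cells Pcell_face_iff by simp
qed

end
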